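(* Let $\gamma(s)$ be an arc-length parametrized triharmonic curve with vanishing torsion immersed in a BCV space $M(a,b)$ with $4a\neq b^2$. Then either $\gamma$ is a geodesic, or $\gamma$ is a Frenet helix whose constant curvature $\kappa_o$ satisfies $$\kappa_o^2=2\left(\frac{b^2}{4}+\left[4a-b^2\right]B_3^2\right),$$ where $B_3=\langle B,E_3\rangle$ is constant along $\gamma$ and satisfies $B_3^2<\dfrac{b^2}{4(b^2-4a)}$ if $b^2>4a$, and $B_3\neq 0$ if $b^2<4a$. In particular, there are no proper triharmonic curves with vanishing torsion in the product space $\mathbb{H}^2(4a)\times\mathbb{R}$ (i.e. $M(a,0)$ with $a<0$).
   Context: For real $a,b$, the BCV space $M(a,b)$ is $\{(x,y,z)\in\mathbb{R}^3:\lambda_a=1+a(x^2+y^2)>0\}$ with the metric $$g_{a,b}=\frac{dx^2+dy^2}{[1+a(x^2+y^2)]^2}+\left(dz+\frac{b}{2}\,\frac{y\,dx-x\,dy}{1+a(x^2+y^2)}\right)^2,$$ with orthonormal frame $E_1=\lambda_a\partial_x-\frac{by}{2}\partial_z$, $E_2=\lambda_a\partial_y+\frac{bx}{2}\partial_z$, $E_3=\partial_z$. For an arc-length parametrized curve $\gamma$ with $T=\gamma'$ in a Riemannian manifold with Levi-Civita connection $\nabla$ and curvature tensor $R^M(X,Y)=\nabla_X\nabla_Y-\nabla_Y\nabla_X-\nabla_{[X,Y]}$, $\gamma$ is triharmonic if $\nabla_T^5T+R^M(\nabla_T^3T,T)T-R^M(\nabla_T^2T,\nabla_TT)T=0$;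 proper means not a geodesic. For a non-geodesic curve, the Frenet frame $\{T,N,B\}$ (with $B=T\times N$), curvature $\kappa$ and torsion $\tau$ are given by $\nabla_TT=\kappa N$, $\nabla_TN=-\kappa T+\tau B$, $\nabla_TB=-\tau N$. A Frenet helix is a curve with constant curvature and constant torsion. *)

theory Defs
  imports "HOL-Analysis.Analysis"
begin

text \<open>Points of R^3 are vectors p :: real^3 with coordinates x = p$1, y = p$2, z = p$3.
  Tangent vectors are expressed by their components w.r.t. the coordinate basis
  d/dx, d/dy, d/dz.\<close>

definition bcv_lambda :: "real \<Rightarrow> real^3 \<Rightarrow> real" where
  "bcv_lambda a p = 1 + a * ((p$1)^2 + (p$2)^2)"

definition bcv_domain :: "real \<Rightarrow> (real^3) set" where
  "bcv_domain a = {p. bcv_lambda a p > 0}"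

text \<open>Metric coefficients g_ij of g_{a,b}: (dx^2+dy^2)/lambda^2 + omega (x) omega with
  omega = dz + (b/2)(y dx - x dy)/lambda.\<close>
definition bcv_g :: "real \<Rightarrow> real \<Rightarrow> real^3 \<Rightarrow> real^3^3" where
  "bcv_g a b p = (let l = bcv_lambda a p;
      w = (\<chi> i. if i = 1 then (b/2) * p$2 / l else if i = 2 then - (b/2) * p$1 / l else 1) :: real^3
    in \<chi> i j. (if i = j \<and> i \<noteq> 3 then 1 / l^2 else 0) + w$i * w$j)"

definition g_inner :: "real \<Rightarrow> real \<Rightarrow> real^3 \<Rightarrow> real^3 \<Rightarrow> real^3 \<Rightarrow> real" where
  "g_inner a b p u v = (\<Sum>i\<in>UNIV. \<Sum>j\<in>UNIV. bcv_g a b p $ i $ j * u$i * v$j)"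

definition coord_partial :: "3 \<Rightarrow> (real^3 \<Rightarrow> real) \<Rightarrow> real^3 \<Rightarrow> real" where
  "coord_partial i f p = deriv (\<lambda>t. f (p + t *\<^sub>R axis i 1)) 0"

definition christoffel :: "real \<Rightarrow> real \<Rightarrow> 3 \<Rightarrow> 3 \<Rightarrow> 3 \<Rightarrow> real^3 \<Rightarrow> real" where
  "christoffel a b k i j p = 1/2 * (\<Sum>l\<in>UNIV. matrix_inv (bcv_g a b p) $ k $ l *
      (coord_partial i (\<lambda>q. bcv_g a b q $ j $ l) p + coord_partial j (\<lambda>q. bcv_g a b q $ i $ l) p
       - coord_partial l (\<lambda>q. bcv_g a b q $ i $ j) p))"

text \<open>R(d_i,d_j)d_k = R^l_ijk d_l with R(X,Y) = nabla_X nabla_Y - nabla_Y nabla_X - nabla_[X,Y].\<close>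
definition riemann_coef :: "real \<Rightarrow> real \<Rightarrow> 3 \<Rightarrow> 3 \<Rightarrow> 3 \<Rightarrow> 3 \<Rightarrow> real^3 \<Rightarrow> real" where
  "riemann_coef a b l i j k p =
     coord_partial i (christoffel a b l j k) p - coord_partial j (christoffel a b l i k) p
     + (\<Sum>m\<in>UNIV. christoffel a b m j k p * christoffel a b l i m p
                  - christoffel a b m i k p * christoffel a b l j m p)"

definition curv :: "real \<Rightarrow> real \<Rightarrow> real^3 \<Rightarrow> real^3 \<Rightarrow> real^3 \<Rightarrow> real^3 \<Rightarrow> real^3" where
  "curv a b p X Y Z = (\<chi> l. \<Sum>i\<in>UNIV. \<Sum>j\<in>UNIV. \<Sum>k\<in>UNIV. X$i * Y$j * Z$k * riemann_coef a b l i j k p)"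

definition vel :: "(real \<Rightarrow> real^3) \<Rightarrow> real \<Rightarrow> real^3" where
  "vel c s = (\<chi> i. deriv (\<lambda>t. c t $ i) s)"

definition covD :: "real \<Rightarrow> real \<Rightarrow> (real \<Rightarrow> real^3) \<Rightarrow> (real \<Rightarrow> real^3) \<Rightarrow> real \<Rightarrow> real^3" where
  "covD a b c V s = (\<chi> k. deriv (\<lambda>t. V t $ k) s
      + (\<Sum>i\<in>UNIV. \<Sum>j\<in>UNIV. christoffel a b k i j (c s) * vel c s $ i * V s $ j))"

definition smooth_curve :: "real set \<Rightarrow> (real \<Rightarrow> real^3) \<Rightarrow> bool" where
  "smooth_curve I c \<longleftrightarrow> (\<forall>k n. \<forall>s\<in>I. ((deriv ^^ n) (\<lambda>t. c t $ k)) differentiable (at s))"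

definition unit_speed :: "real \<Rightarrow> real \<Rightarrow> real set \<Rightarrow> (real \<Rightarrow> real^3) \<Rightarrow> bool" where
  "unit_speed a b I c \<longleftrightarrow> (\<forall>s\<in>I. g_inner a b (c s) (vel c s) (vel c s) = 1)"

definition triharmonic :: "real \<Rightarrow> real \<Rightarrow> real set \<Rightarrow> (real \<Rightarrow> real^3) \<Rightarrow> bool" where
  "triharmonic a b I c \<longleftrightarrow> (\<forall>s\<in>I.
     (covD a b c ^^ 5) (vel c) s
     + curv a b (c s) ((covD a b c ^^ 3) (vel c) s) (vel c s) (vel c s)
     - curv a b (c s) ((covD a b c ^^ 2) (vel c) s) (covD a b c (vel c) s) (vel c s) = 0)"

definition geodesic :: "real \<Rightarrow> real \<Rightarrow> real set \<Rightarrow> (real \<Rightarrow> real^3) \<Rightarrow> bool" where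
  "geodesic a b I c \<longleftrightarrow> (\<forall>s\<in>I. covD a b c (vel c) s = 0)"

text \<open>Orthonormal frame E1, E2, E3 in coordinate components.\<close>
definition bcv_E :: "real \<Rightarrow> real \<Rightarrow> real^3 \<Rightarrow> 3 \<Rightarrow> real^3" where
  "bcv_E a b p i =
     (if i = 1 then (\<chi> j. if j = 1 then bcv_lambda a p else if j = 2 then 0 else - b * p$2 / 2)
      else if i = 2 then (\<chi> j. if j = 1 then 0 else if j = 2 then bcv_lambda a p else b * p$1 / 2)
      else axis 3 1)"

definition g_cross :: "real \<Rightarrow> real \<Rightarrow> real^3 \<Rightarrow> real^3 \<Rightarrow> real^3 \<Rightarrow> real^3" where
  "g_cross a b p u v = (let fu = (\<chi> i. g_inner a b p u (bcv_E a b p i));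
                            fv = (\<chi> i. g_inner a b p v (bcv_E a b p i));
                            w = cross3 fu fv
                        in \<Sum>i\<in>UNIV. w$i *\<^sub>R bcv_E a b p i)"

definition frenet :: "real \<Rightarrow> real \<Rightarrow> real set \<Rightarrow> (real \<Rightarrow> real^3) \<Rightarrow> (real \<Rightarrow> real)
    \<Rightarrow> (real \<Rightarrow> real^3) \<Rightarrow> (real \<Rightarrow> real^3) \<Rightarrow> (real \<Rightarrow> real) \<Rightarrow> bool" where
  "frenet a b I c \<kappa> N B \<tau> \<longleftrightarrow> (\<forall>s\<in>I.
     \<kappa> s > 0 \<and>
     g_inner a b (c s) (N s) (N s) = 1 \<and> g_inner a b (c s) (N s) (vel c s) = 0 \<and>
     B s = g_cross a b (c s) (vel c s) (N s) \<and>
     (\<forall>k. (\<lambda>t. N t $ k) differentiable (at s) \<and> (\<lambda>t. B t $ k) differentiable (at s)) \<and>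
     covD a b c (vel c) s = \<kappa> s *\<^sub>R N s \<and>
     covD a b c N s = - \<kappa> s *\<^sub>R vel c s + \<tau> s *\<^sub>R B s \<and>
     covD a b c B s = - \<tau> s *\<^sub>R N s)"

end

theory Submission
  imports Defs "HOL-Computational_Algebra.Polynomial"
begin

text \<open>Without torsion the iterated covariant derivatives of \<open>T\<close> stay in the span of \<open>T\<close> and \<open>N\<close>, and
  both curvature terms are multiples of \<open>R(N,T)T\<close>, whose \<open>N\<close>-component is
  \<open>K = b\<^sup>2/4 + (4 a - b\<^sup>2) B\<^sub>3\<^sup>2\<close> and whose \<open>B\<close>-component is a multiple of \<open>N\<^sub>3 B\<^sub>3\<close>.
  The \<open>B\<close>-component of the equation forces \<open>N\<^sub>3 B\<^sub>3 = 0\<close>: otherwise \<open>\<kappa>'' = 2 \<kappa>\<^sup>3\<close> on an open set, and the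
  \<open>T\<close>-component then gives \<open>\<kappa>' = 0\<close>, which is absurd. As \<open>B\<^sub>3' = b/2 N\<^sub>3\<close>, both \<open>B\<^sub>3\<close> and \<open>K\<close> are constant.
  The \<open>T\<close>-component has the first integral \<open>E = \<kappa> \<kappa>'' + \<kappa>'\<^sup>2/2 - \<kappa>\<^sup>4/2\<close>, which turns the \<open>N\<close>-component into a
  polynomial relation between \<open>\<kappa>\<close> and \<open>\<kappa>'\<^sup>2\<close>. Where \<open>\<kappa>' \<noteq> 0\<close> it can be differentiated along the curve, and
  eliminating \<open>\<kappa>'\<^sup>2\<close> leaves a nontrivial polynomial equation for \<open>\<kappa>\<^sup>2\<close>. Hence \<open>\<kappa>\<close> is constant and the
  \<open>N\<close>-component reads \<open>\<kappa>\<^sup>2 = 2 K\<close>.\<close>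

section \<open>Christoffel symbols and curvature of the BCV metric\<close>

text \<open>With this reciprocal as an extra variable, the metric and all quantities derived from it
  are polynomials. Their identities then follow by ring reasoning, where necessary modulo the single
  relation \<open>rlam_mult\<close>.\<close>

definition rlam :: "real \<Rightarrow> real^3 \<Rightarrow> real" where
  "rlam a p = inverse (bcv_lambda a p)"

text \<open>The coefficients of the one-form dual to E3: for a vector V at p,
  \<open>bcv_form a b p \<bullet> V\<close> is the vertical component of V. The metric is the square
  of this form plus the horizontal part \<open>(rlam a p)^2\<close> times dx^2 + dy^2.\<close>

definition bcv_form :: "real \<Rightarrow> real \<Rightarrow> real^3 \<Rightarrow> real^3" where
  "bcv_form a b p = vector [b/2 * p$2 * rlam a p, - (b/2) * p$1 * rlam a p, 1]"

lemma rlam_mult: "p \<in> bcv_domain a \<Longrightarrow> (1 + a * ((p$1)^2 + (p$2)^2)) * rlam a p = 1"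
  by (auto simp: bcv_domain_def rlam_def bcv_lambda_def)

lemma bcv_form_simps [simp]:
  "bcv_form a b p $ 1 = b/2 * p$2 * rlam a p"
  "bcv_form a b p $ 2 = - (b/2) * p$1 * rlam a p"
  "bcv_form a b p $ 3 = 1"
  by (simp_all add: bcv_form_def)

lemma bcv_g_nth:
  "bcv_g a b p $ i $ j = (if i = j \<and> i \<noteq> 3 then (rlam a p)^2 else 0) + bcv_form a b p $ i * bcv_form a b p $ j"
  using exhaust_3[of i] exhaust_3[of j] by (auto simp: bcv_g_def Let_def rlam_def field_simps)

text \<open>\<open>matrix_inv\<close> chooses some two-sided inverse. For square matrices a
  one-sided inverse is two-sided and unique, so checking one product identifies the choice.\<close>

lemma matrix_inv_eqI:
  fixes A B :: "real^'n^'n"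
  assumes "A ** B = mat 1"
  shows "matrix_inv A = B"
proof -
  have BA: "B ** A = mat 1" using assms matrix_left_right_inverse by blast
  have "A ** matrix_inv A = mat 1" unfolding matrix_inv_def
    by (rule someI2[where a = B]) (use assms BA in auto)
  then have "B ** (A ** matrix_inv A) = B" by simp
  then show ?thesis by (simp add: matrix_mul_assoc BA)
qed

text \<open>This is the sum of the products of each frame vector E1, E2, E3 with its own transpose,
  which inverts the metric because the frame is orthonormal.\<close>

definition bcv_ginv :: "real \<Rightarrow> real \<Rightarrow> real^3 \<Rightarrow> real^3^3" where
  "bcv_ginv a b p = (let l = bcv_lambda a p in
     vector [vector [l^2, 0, - l * b * p$2 / 2],
             vector [0, l^2, l * b * p$1 / 2],
             vector [- l * b * p$2 / 2, l * b * p$1 / 2, 1 + b^2 * ((p$1)^2 + (p$2)^2) / 4]])"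

lemma matrix_inv_bcv_g:
  assumes "p \<in> bcv_domain a"
  shows "matrix_inv (bcv_g a b p) = bcv_ginv a b p"
proof (rule matrix_inv_eqI)
  have r: "bcv_lambda a p * rlam a p = 1" using assms by (auto simp: bcv_domain_def rlam_def)
  \<comment> \<open>Replacing b by twice a new variable clears the denominators before
    \<open>algebra\<close> is called.\<close>
  obtain \<beta> where b: "b = 2 * \<beta>" by (metis mult.commute nonzero_eq_divide_eq zero_neq_numeral)
  show "bcv_g a b p ** bcv_ginv a b p = mat 1"
    apply (simp add: vec_eq_iff forall_3 matrix_matrix_mult_def sum_3 bcv_g_nth bcv_ginv_def Let_def
      mat_def b del: mult_cancel_left mult_cancel_right)
    using r by (intro conjI; algebra)
qed

section \<open>Partial derivatives of the metric coefficients\<close>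

definition rlam_partial :: "real \<Rightarrow> 3 \<Rightarrow> real^3 \<Rightarrow> real" where
  "rlam_partial a i p = (if i = 3 then 0 else - 2 * a * p$i * (rlam a p)^2)"

lemma rlam_has_deriv:
  assumes "p \<in> bcv_domain a"
  shows "((\<lambda>t. rlam a (p + t *\<^sub>R axis i 1)) has_real_derivative rlam_partial a i p) (at 0)"
  using assms exhaust_3[of i] unfolding rlam_def bcv_lambda_def bcv_domain_def rlam_partial_def
  by (auto simp: axis_def field_simps power2_eq_square intro!: derivative_eq_intros)

definition form_partial :: "real \<Rightarrow> real \<Rightarrow> 3 \<Rightarrow> 3 \<Rightarrow> real^3 \<Rightarrow> real" where
  "form_partial a b i j p = (if j = 1 then b/2 * ((if i = 2 then rlam a p else 0) + p$2 * rlam_partial a i p)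
     else if j = 2 then - (b/2) * ((if i = 1 then rlam a p else 0) + p$1 * rlam_partial a i p) else 0)"

lemma axis_nth_eq: "axis i (1::real) $ j = (if j = i then 1 else 0)"
  by (simp add: axis_def)

lemma bcv_form_has_deriv:
  assumes "p \<in> bcv_domain a"
  shows "((\<lambda>t. bcv_form a b (p + t *\<^sub>R axis i 1) $ j) has_real_derivative form_partial a b i j p) (at 0)"
  using exhaust_3[of i] exhaust_3[of j] unfolding form_partial_def
  by (auto simp: axis_nth_eq algebra_simps intro!: derivative_eq_intros rlam_has_deriv[OF assms])

lemma coord_partial_eqI:
  "((\<lambda>t. f (p + t *\<^sub>R axis i 1)) has_real_derivative D) (at 0) \<Longrightarrow> coord_partial i f p = D"
  unfolding coord_partial_def by (rule DERIV_imp_deriv)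

lemma coord_partial_g:
  assumes "p \<in> bcv_domain a"
  shows "coord_partial i (\<lambda>q. bcv_g a b q $ j $ l) p
    = (if j = l \<and> j \<noteq> 3 then 2 * rlam a p * rlam_partial a i p else 0)
      + form_partial a b i j p * bcv_form a b p $ l + bcv_form a b p $ j * form_partial a b i l p"
  unfolding bcv_g_nth
  by (rule coord_partial_eqI) (auto intro!: derivative_eq_intros rlam_has_deriv bcv_form_has_deriv assms)

lemma bcv_ginv_nth:
  "bcv_ginv a b p $ 1 $ 1 = (bcv_lambda a p)^2"
  "bcv_ginv a b p $ 1 $ 2 = 0"
  "bcv_ginv a b p $ 1 $ 3 = - (b/2) * bcv_lambda a p * p$2"
  "bcv_ginv a b p $ 2 $ 1 = 0"
  "bcv_ginv a b p $ 2 $ 2 = (bcv_lambda a p)^2"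
  "bcv_ginv a b p $ 2 $ 3 = (b/2) * bcv_lambda a p * p$1"
  "bcv_ginv a b p $ 3 $ 1 = - (b/2) * bcv_lambda a p * p$2"
  "bcv_ginv a b p $ 3 $ 2 = (b/2) * bcv_lambda a p * p$1"
  "bcv_ginv a b p $ 3 $ 3 = 1 + (b/2)^2 * ((p $ 1)^2 + (p $ 2)^2)"
  by (simp_all add: bcv_ginv_def Let_def power2_eq_square)

text \<open>With \<open>L = 1/\<lambda>\<close>, the Christoffel symbols are linear combinations of \<open>1\<close>, \<open>x L\<close>, \<open>y L\<close>, \<open>x y L\<^sup>2\<close>
  and \<open>(x\<^sup>2 - y\<^sup>2) L\<^sup>2\<close>. These are the arguments \<open>c\<close>, \<open>u\<close>, \<open>v\<close>, \<open>w\<close>, \<open>z\<close>, so that the table with the derivatives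
  of these functions as arguments gives the derivatives of the symbols.\<close>

definition christoffel_table :: "real \<Rightarrow> real \<Rightarrow> 3 \<Rightarrow> 3 \<Rightarrow> 3 \<Rightarrow> real \<Rightarrow> real \<Rightarrow> real \<Rightarrow> real \<Rightarrow> real \<Rightarrow> real" where
  "christoffel_table a b k i j c u v w z =
    (if k = 1 then
       if i = 1 \<and> j = 1 then - 2 * a * u
       else if i = 2 \<and> j = 2 then 2 * (a - (b/2)^2) * u
       else if {i, j} = {1, 2} then ((b/2)^2 - 2 * a) * v
       else if {i, j} = {2, 3} then b/2 * c else 0
     else if k = 2 then
       if i = 1 \<and> j = 1 then 2 * (a - (b/2)^2) * v
       else if i = 2 \<and> j = 2 then - 2 * a * v
       else if {i, j} = {1, 2} then ((b/2)^2 - 2 * a) * u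
       else if {i, j} = {1, 3} then - (b/2) * c else 0
     else
       if i = 1 \<and> j = 1 then b * (a - (b/2)^2) * w
       else if i = 2 \<and> j = 2 then b * ((b/2)^2 - a) * w
       else if {i, j} = {1, 2} then (b/2) * ((b/2)^2 - a) * z
       else if {i, j} = {1, 3} then - ((b/2)^2) * u
       else if {i, j} = {2, 3} then - ((b/2)^2) * v else 0)"

lemma christoffel_table_has_deriv:
  assumes "(u has_real_derivative u') (at x within S)" "(v has_real_derivative v') (at x within S)"
    "(w has_real_derivative w') (at x within S)" "(z has_real_derivative z') (at x within S)"
  shows "((\<lambda>t. christoffel_table a b k i j c (u t) (v t) (w t) (z t)) has_real_derivative christoffel_table a b k i j 0 u' v' w' z') (at x within S)"
proof -
  have if_deriv: "(P \<Longrightarrow> (f has_real_derivative D) (at x within S)) \<Longrightarrow> (\<not> P \<Longrightarrow> (g has_real_derivative E) (at x within S))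
    \<Longrightarrow> ((\<lambda>t. if P then f t else g t) has_real_derivative (if P then D else E)) (at x within S)" for P f g D E
    by auto
  show ?thesis unfolding christoffel_table_def
    by (intro if_deriv assms DERIV_const DERIV_cmult)
qed

definition bcv_christoffel :: "real \<Rightarrow> real \<Rightarrow> 3 \<Rightarrow> 3 \<Rightarrow> 3 \<Rightarrow> real^3 \<Rightarrow> real" where
  "bcv_christoffel a b k i j p = (let x = p$1; y = p$2; L = rlam a p in
     christoffel_table a b k i j 1 (x * L) (y * L) (x * y * L^2) ((x^2 - y^2) * L^2))"

text \<open>The inverse metric contributes powers of \<lambda> and the derivatives of the metric
  powers of \<open>rlam\<close>. Once \<open>rlam_mult\<close> cancels them, every one of the 27
  entries is a polynomial identity.\<close>

lemma christoffel_eq: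
  assumes "p \<in> bcv_domain a"
  shows "christoffel a b k i j p = bcv_christoffel a b k i j p"
proof -
  note r = rlam_mult[OF assms]
  obtain \<beta> where b: "b = 2 * \<beta>" by (metis mult.commute nonzero_eq_divide_eq zero_neq_numeral)
  have "\<forall>k i j. christoffel a b k i j p = bcv_christoffel a b k i j p"
    unfolding forall_3
    apply (simp add: christoffel_def bcv_christoffel_def Let_def matrix_inv_bcv_g assms coord_partial_g
      sum_3 christoffel_table_def bcv_ginv_nth form_partial_def rlam_partial_def doubleton_eq_iff b
      bcv_lambda_def del: mult_cancel_left mult_cancel_right)
    using r by (intro conjI; algebra)
  then show ?thesis by blast
qed

text \<open>The factors \<open>l\<close> come from multiplying terms of lower degree in \<open>L\<close> by \<open>l L = 1\<close>. This makes the
  derivatives homogeneous in \<open>L\<close>, and the verification of the curvature tensor a pure ring identity.\<close>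

definition bcv_christoffel_partial :: "real \<Rightarrow> real \<Rightarrow> 3 \<Rightarrow> 3 \<Rightarrow> 3 \<Rightarrow> 3 \<Rightarrow> real^3 \<Rightarrow> real" where
  "bcv_christoffel_partial a b m k i j p = (let x = p$1; y = p$2; L = rlam a p; l = 1 + a * (x^2 + y^2);
     q = (if m = 3 then 0 else 2 * a * p$m);
     dx = (if m = 1 then 1 else 0); dy = (if m = 2 then 1 else 0) in
     christoffel_table a b k i j 0 ((dx * l - x * q) * L^2) ((dy * l - y * q) * L^2)
       (((dx * y + x * dy) * l - 2 * x * y * q) * L^3)
       (2 * ((x * dx - y * dy) * l - (x^2 - y^2) * q) * L^3))"

lemma bcv_christoffel_has_deriv:
  assumes "p \<in> bcv_domain a"
  shows "((\<lambda>t. bcv_christoffel a b k i j (p + t *\<^sub>R axis m 1)) has_real_derivative bcv_christoffel_partial a b m k i j p) (at 0)"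
proof -
  note r = rlam_mult[OF assms]
  then have r2: "rlam a p = (1 + a * ((p$1)^2 + (p$2)^2)) * (rlam a p)^2"
    by algebra
  from r have r3: "(rlam a p)^2 = (1 + a * ((p$1)^2 + (p$2)^2)) * (rlam a p)^3"
    by algebra
  let ?q = "\<lambda>t. p + t *\<^sub>R axis m 1"
  let ?x = "p$1" and ?y = "p$2" and ?L = "rlam a p" and ?dL = "rlam_partial a m p"
  let ?dx = "if m = 1 then 1 else 0" and ?dy = "if m = 2 then 1 else 0"
  note d = derivative_eq_intros rlam_has_deriv[OF assms]
  show ?thesis unfolding bcv_christoffel_def bcv_christoffel_partial_def Let_def
  proof (rule christoffel_table_has_deriv)
    have "((\<lambda>t. ?q t $ 1 * rlam a (?q t)) has_real_derivative ?dx * ?L + ?x * ?dL) (at 0)"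
      by (auto simp: axis_nth_eq algebra_simps intro!: d)
    also have "?dx * ?L + ?x * ?dL = (?dx * (1 + a * (?x^2 + ?y^2)) - ?x * (if m = 3 then 0 else 2 * a * p$m)) * ?L^2"
      by (subst r2) (simp add: rlam_partial_def algebra_simps)
    finally show "((\<lambda>t. ?q t $ 1 * rlam a (?q t)) has_real_derivative \<dots>) (at 0)" .
    have "((\<lambda>t. ?q t $ 2 * rlam a (?q t)) has_real_derivative ?dy * ?L + ?y * ?dL) (at 0)"
      by (auto simp: axis_nth_eq algebra_simps intro!: d)
    also have "?dy * ?L + ?y * ?dL = (?dy * (1 + a * (?x^2 + ?y^2)) - ?y * (if m = 3 then 0 else 2 * a * p$m)) * ?L^2"
      by (subst r2) (simp add: rlam_partial_def algebra_simps)
    finally show "((\<lambda>t. ?q t $ 2 * rlam a (?q t)) has_real_derivative \<dots>) (at 0)" .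
    have "((\<lambda>t. ?q t $ 1 * ?q t $ 2 * (rlam a (?q t))^2) has_real_derivative
       (?dx * ?y + ?x * ?dy) * ?L^2 + ?x * ?y * (2 * ?L * ?dL)) (at 0)"
      by (auto simp: axis_nth_eq algebra_simps intro!: d)
    also have "(?dx * ?y + ?x * ?dy) * ?L^2 + ?x * ?y * (2 * ?L * ?dL)
      = ((?dx * ?y + ?x * ?dy) * (1 + a * (?x^2 + ?y^2)) - 2 * ?x * ?y * (if m = 3 then 0 else 2 * a * p$m)) * ?L^3"
      by (subst r3) (simp add: rlam_partial_def algebra_simps power2_eq_square power3_eq_cube)
    finally show "((\<lambda>t. ?q t $ 1 * ?q t $ 2 * (rlam a (?q t))^2) has_real_derivative \<dots>) (at 0)" .
    have "((\<lambda>t. ((?q t $ 1)^2 - (?q t $ 2)^2) * (rlam a (?q t))^2) has_real_derivative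
       (2 * ?x * ?dx - 2 * ?y * ?dy) * ?L^2 + (?x^2 - ?y^2) * (2 * ?L * ?dL)) (at 0)"
      by (auto simp: axis_nth_eq algebra_simps intro!: d)
    also have "(2 * ?x * ?dx - 2 * ?y * ?dy) * ?L^2 + (?x^2 - ?y^2) * (2 * ?L * ?dL)
      = 2 * ((?x * ?dx - ?y * ?dy) * (1 + a * (?x^2 + ?y^2)) - (?x^2 - ?y^2) * (if m = 3 then 0 else 2 * a * p$m)) * ?L^3"
      by (subst r3) (simp add: rlam_partial_def algebra_simps power2_eq_square power3_eq_cube)
    finally show "((\<lambda>t. ((?q t $ 1)^2 - (?q t $ 2)^2) * (rlam a (?q t))^2) has_real_derivative \<dots>) (at 0)" .
  qed
qed

section \<open>The curvature tensor in closed form\<close>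

lemma open_bcv_domain: "open (bcv_domain a)"
  unfolding bcv_domain_def bcv_lambda_def
  by (intro open_Collect_less continuous_intros)

lemma coord_partial_christoffel:
  assumes "p \<in> bcv_domain a"
  shows "coord_partial m (christoffel a b k i j) p = bcv_christoffel_partial a b m k i j p"
proof (rule coord_partial_eqI, rule has_field_derivative_transform_within_open[OF bcv_christoffel_has_deriv[OF assms]])
  \<comment> \<open>The closed form of \<open>christoffel\<close> is known only inside the domain.
    The coordinate line stays in the domain for parameters near 0, which is all that the derivative
    at 0 needs.\<close>
  let ?S = "(\<lambda>t::real. p + t *\<^sub>R axis m 1) -` bcv_domain a"
  show "open ?S" by (intro open_vimage open_bcv_domain continuous_intros)
  show "0 \<in> ?S" using assms by simp
qed (simp add: christoffel_eq)

text \<open>A constant-curvature type tensor plus a correction along E3 = d/dz, which is why the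
  last term occurs for l = 3 only. The correction carries the factor 4a - b^2 and disappears when 4a
  = b^2, the case of constant sectional curvature.\<close>

definition bcv_riemann :: "real \<Rightarrow> real \<Rightarrow> 3 \<Rightarrow> 3 \<Rightarrow> 3 \<Rightarrow> 3 \<Rightarrow> real^3 \<Rightarrow> real" where
  "bcv_riemann a b l i j k p = (let g = bcv_g a b p; w = bcv_form a b p; d = (\<lambda>m. if m = l then 1 else 0) in
     (4 * a - 3 * (b/2)^2) * (g$j$k * d i - g$i$k * d j)
     - (4 * a - b^2) * (w$j * w$k * d i - w$i * w$k * d j + (w$i * g$j$k - w$j * g$i$k) * (if l = 3 then 1 else 0)))"

lemma riemann_coef_skew: "riemann_coef a b l j i k p = - riemann_coef a b l i j k p"
  by (simp add: riemann_coef_def sum_subtractf)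

lemma bcv_riemann_skew: "bcv_riemann a b l j i k p = - bcv_riemann a b l i j k p"
  by (simp add: bcv_riemann_def Let_def algebra_simps)

text \<open>Both sides are skew in i and j. Hence they vanish for i = j, and only the index pairs
  (1,2), (1,3) and (2,3) have to be computed.\<close>

lemma riemann_coef_eq:
  assumes p: "p \<in> bcv_domain a"
  shows "riemann_coef a b l i j k p = bcv_riemann a b l i j k p"
proof -
  obtain \<beta> where b: "b = 2 * \<beta>" by (metis mult.commute nonzero_eq_divide_eq zero_neq_numeral)
  note S = riemann_coef_def coord_partial_christoffel christoffel_eq bcv_riemann_def sum_3 bcv_g_nth
       bcv_christoffel_partial_def christoffel_table_def bcv_christoffel_def Let_def doubleton_eq_iff bcv_lambda_def
  have "\<forall>l k. riemann_coef a b l 1 2 k p = bcv_riemann a b l 1 2 k p"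
    unfolding forall_3
    by (simp add: S b p del: mult_cancel_left mult_cancel_right; intro conjI; algebra)
  moreover have "\<forall>l k. riemann_coef a b l 1 3 k p = bcv_riemann a b l 1 3 k p"
    unfolding forall_3
    by (simp add: S b p del: mult_cancel_left mult_cancel_right; intro conjI; algebra)
  moreover have "\<forall>l k. riemann_coef a b l 2 3 k p = bcv_riemann a b l 2 3 k p"
    unfolding forall_3
    by (simp add: S b p del: mult_cancel_left mult_cancel_right; intro conjI; algebra)
  moreover have "riemann_coef a b l i i k p = bcv_riemann a b l i i k p" for i
    using riemann_coef_skew[of a b l i i k p] bcv_riemann_skew[of a b l i i k p] by simp
  ultimately show ?thesis using exhaust_3[of i] exhaust_3[of j]
    by (metis riemann_coef_skew bcv_riemann_skew)
qed

lemma curv_eq: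
  assumes p: "p \<in> bcv_domain a"
  shows "curv a b p X Y Z =
    (let g = g_inner a b p; w = (\<lambda>V. bcv_form a b p \<bullet> V) in
    (4 * a - 3 * (b/2)^2) *\<^sub>R (g Y Z *\<^sub>R X - g X Z *\<^sub>R Y)
    - (4 * a - b^2) *\<^sub>R ((w Y * w Z) *\<^sub>R X - (w X * w Z) *\<^sub>R Y
       + (w X * g Y Z - w Y * g X Z) *\<^sub>R axis 3 1))" (is "_ = ?R")
proof -
  have "curv a b p X Y Z $ l = ?R $ l" for l
  proof -
    \<comment> \<open>The contraction is multilinear algebra valid for any matrix, covector and
      constants, so these are kept opaque.\<close>
    define G where "G = bcv_g a b p"
    define w where "w = bcv_form a b p"
    define \<alpha> where "\<alpha> = 4 * a - 3 * (b/2)^2"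
    define \<beta> where "\<beta> = 4 * a - b^2"
    show ?thesis
      using exhaust_3[of l]
      unfolding curv_def riemann_coef_eq[OF p] bcv_riemann_def Let_def g_inner_def
      unfolding G_def[symmetric] w_def[symmetric] \<alpha>_def[symmetric] \<beta>_def[symmetric]
      by (elim disjE) (simp_all add: sum_3 inner_vec_def axis_nth_eq algebra_simps)
  qed
  then show ?thesis by (simp add: vec_eq_iff)
qed

text \<open>The components of a vector in the frame E1, E2, E3. They turn \<open>g_inner\<close>
  into the Euclidean inner product and \<open>g_cross\<close> into \<open>cross3\<close>.\<close>

definition coframe :: "real \<Rightarrow> real \<Rightarrow> real^3 \<Rightarrow> real^3 \<Rightarrow> real^3" where
  "coframe a b p u = vector [rlam a p * u$1, rlam a p * u$2, bcv_form a b p \<bullet> u]"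

lemma coframe_simps:
  "coframe a b p u $ 1 = rlam a p * u$1"
  "coframe a b p u $ 2 = rlam a p * u$2"
  "coframe a b p u $ 3 = bcv_form a b p \<bullet> u"
  by (simp_all add: coframe_def)

lemma coframe_linear:
  "coframe a b p (u + v) = coframe a b p u + coframe a b p v"
  "coframe a b p (u - v) = coframe a b p u - coframe a b p v"
  "coframe a b p (c *\<^sub>R u) = c *\<^sub>R coframe a b p u"
  "coframe a b p 0 = 0"
  by (simp_all add: vec_eq_iff forall_3 coframe_simps inner_simps algebra_simps)

lemma g_inner_coframe: "g_inner a b p u v = coframe a b p u \<bullet> coframe a b p v"
  by (simp add: g_inner_def bcv_g_nth inner_vec_def sum_3 coframe_simps algebra_simps power2_eq_square)

lemma coframe_E:
  assumes p: "p \<in> bcv_domain a"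
  shows "coframe a b p (bcv_E a b p i) = axis i 1"
proof -
  have r: "rlam a p * bcv_lambda a p = 1" using p by (auto simp: bcv_domain_def rlam_def)
  then have "b / 2 * p $ 2 * rlam a p * bcv_lambda a p = b / 2 * p $ 2" "b / 2 * p $ 1 * rlam a p * bcv_lambda a p = b / 2 * p $ 1"
    by (simp_all add: mult.assoc)
  then show ?thesis using exhaust_3[of i] r
    by (auto simp: vec_eq_iff forall_3 coframe_simps bcv_E_def inner_vec_def sum_3 axis_nth_eq)
qed

lemma coframe_axis_3: "coframe a b p (axis 3 1) = axis 3 1"
  by (auto simp: vec_eq_iff forall_3 coframe_simps inner_vec_def sum_3 axis_nth_eq)

lemma coframe_sum: "coframe a b p (sum f S) = (\<Sum>i\<in>S. coframe a b p (f i))"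
  by (induction S rule: infinite_finite_induct) (simp_all add: coframe_linear)

lemma coframe_cross:
  assumes p: "p \<in> bcv_domain a"
  shows "coframe a b p (g_cross a b p u v) = cross3 (coframe a b p u) (coframe a b p v)"
proof -
  have "(\<chi> i. g_inner a b p u (bcv_E a b p i)) = coframe a b p u" for u
    by (simp add: g_inner_coframe coframe_E[OF p] inner_axis vec_eq_iff)
  then show ?thesis
    by (simp add: g_cross_def Let_def coframe_sum coframe_linear coframe_E[OF p])
      (simp add: vec_eq_iff axis_nth_eq sum_3 forall_3)
qed

section \<open>Constancy of the curvature function\<close>

lemma zero_deriv_of_zero:
  fixes f :: "real \<Rightarrow> real"
  assumes "open I" "s \<in> I" "\<And>t. t \<in> I \<Longrightarrow> f t = 0" "(f has_real_derivative D) (at s)"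
  shows "D = 0"
proof -
  have "((\<lambda>_. 0) has_real_derivative D) (at s)"
    by (rule has_field_derivative_transform_within_open[OF assms(4) assms(1,2)]) (use assms in auto)
  then show ?thesis using DERIV_unique DERIV_const by blast
qed

text \<open>Here \<open>v = \<kappa>\<^sup>2\<close> and \<open>w = \<kappa>\<^sup>4 + \<kappa>'\<^sup>2\<close>. The relation \<open>F = 0\<close> below is \<open>\<kappa>\<^sup>3\<close> times the \<open>N\<close>-component, and
  \<open>G = 0\<close> is \<open>\<kappa>/\<kappa>'\<close> times its derivative. Together they give \<open>w D = M\<close>, and substituting this in \<open>D\<^sup>2 F\<close>
  yields the eliminant.\<close>

definition curvature_eliminant :: "real \<Rightarrow> real \<Rightarrow> real \<Rightarrow> real" where
  "curvature_eliminant E K v =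
    (let M = - 11 * K * v^3 - 60 * E * v^2 + 3 * E * K * v + 12 * E^2;
         D = 42 * v^2 + 3/2 * K * v + 6 * E
     in - 7/2 * M^2 + (8 * E - K * v / 2) * M * D
        + (- 18 * E * v^2 - 2 * E^2 + E * K * v - K * v^3) * D^2)"

lemma curvature_eliminant_eq_0:
  fixes w v E K :: real
  assumes F: "- 7/2 * w^2 + E * (8 * w - 18 * v^2) - 2 * E^2 + K * v * (E - v^2 - w/2) = 0"
    and G: "(- 7 * w + 8 * E - K * v / 2) * (6 * v^2 - w + 2 * E)
      - 72 * E * v^2 + 2 * K * v * E - 6 * K * v^3 - K * v * w = 0"
  shows "curvature_eliminant E K v = 0"
proof -
  define M D where "M = - 11 * K * v^3 - 60 * E * v^2 + 3 * E * K * v + 12 * E^2"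
    and "D = 42 * v^2 + 3/2 * K * v + 6 * E"
  \<comment> \<open>The combination \<open>G + 2 F\<close> is linear in \<open>w\<close>.\<close>
  have "M - w * D = ((- 7 * w + 8 * E - K * v / 2) * (6 * v^2 - w + 2 * E)
      - 72 * E * v^2 + 2 * K * v * E - 6 * K * v^3 - K * v * w)
    + 2 * (- 7/2 * w^2 + E * (8 * w - 18 * v^2) - 2 * E^2 + K * v * (E - v^2 - w/2))"
    unfolding M_def D_def by (simp add: field_simps power2_eq_square power3_eq_cube)
  then have M: "M = w * D" using F G by simp
  have "- 7/2 * M^2 + (8 * E - K * v / 2) * M * D + (- 18 * E * v^2 - 2 * E^2 + E * K * v - K * v^3) * D^2
    = D^2 * (- 7/2 * w^2 + E * (8 * w - 18 * v^2) - 2 * E^2 + K * v * (E - v^2 - w/2))"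
    unfolding M by (simp add: field_simps power2_eq_square power3_eq_cube)
  then show ?thesis using F by (simp add: curvature_eliminant_def Let_def M_def D_def)
qed

text \<open>The eliminant is a nonzero polynomial in v: only the product of the last cubic with D^2
  reaches degree 7, with coefficient -1764 K, and for K = 0 the coefficient of v^6 is -31752
  E.\<close>

lemma finite_roots_curvature_eliminant:
  fixes E K :: real
  assumes "E \<noteq> 0 \<or> K \<noteq> 0"
  shows "finite {v. curvature_eliminant E K v = 0}"
proof -
  define M where "M = [:12 * E^2, 3 * E * K, - 60 * E, - 11 * K:]"
  define D where "D = [:6 * E, 3/2 * K, 42:]"
  define P where "P = [:8 * E, - K/2:]"
  define Q where "Q = [:- 2 * E^2, E * K, - 18 * E, - K:]"
  define R where "R = smult (- 7/2) (M^2) + P * M * D + Q * D^2"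
  have "coeff R 7 = - 1764 * K"
    by (simp add: R_def M_def D_def P_def Q_def eval_nat_numeral)
  moreover have "K = 0 \<Longrightarrow> coeff R 6 = - 31752 * E"
    by (simp add: R_def M_def D_def P_def Q_def eval_nat_numeral)
  ultimately have "R \<noteq> 0" using assms by auto
  then have "finite {v. poly R v = 0}" by (rule poly_roots_finite)
  moreover have "poly R v = curvature_eliminant E K v" for v
  proof -
    have "poly M v = - 11 * K * v^3 - 60 * E * v^2 + 3 * E * K * v + 12 * E^2"
      "poly D v = 42 * v^2 + 3/2 * K * v + 6 * E"
      "poly P v = 8 * E - K * v / 2"
      "poly Q v = - 18 * E * v^2 - 2 * E^2 + E * K * v - K * v^3"
      by (simp_all add: M_def D_def P_def Q_def algebra_simps power2_eq_square power3_eq_cube)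
    then show ?thesis by (simp add: R_def curvature_eliminant_def Let_def)
  qed
  ultimately show ?thesis by simp
qed

text \<open>If \<open>k1\<close> were nonzero at \<open>s0\<close>, then on a ball around
  \<open>s0\<close> all values of \<open>k^2\<close> would be among the finitely many roots of the
  eliminant. A continuous function with finite range on a connected set is constant, so
  \<open>2 * k * k1\<close> would vanish at \<open>s0\<close>.\<close>

lemma curvature_ode_constant:
  fixes k k1 k2 k3 k4 :: "real \<Rightarrow> real" and K :: real
  assumes I: "open I" "is_interval I"
    and d: "\<And>s. s \<in> I \<Longrightarrow> (k has_real_derivative k1 s) (at s)"
      "\<And>s. s \<in> I \<Longrightarrow> (k1 has_real_derivative k2 s) (at s)"
      "\<And>s. s \<in> I \<Longrightarrow> (k2 has_real_derivative k3 s) (at s)"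
      "\<And>s. s \<in> I \<Longrightarrow> (k3 has_real_derivative k4 s) (at s)"
    and pos: "\<And>s. s \<in> I \<Longrightarrow> k s > 0"
    and T: "\<And>s. s \<in> I \<Longrightarrow> 2 * k1 s * k2 s + k s * k3 s = 2 * (k s)^3 * k1 s"
    and N: "\<And>s. s \<in> I \<Longrightarrow> k4 s - 10 * (k s)^2 * k2 s - 15 * k s * (k1 s)^2 + (k s)^5
      + (k2 s - 2 * (k s)^3) * K = 0"
    and s0: "s0 \<in> I"
  shows "k1 s0 = 0"
proof (rule ccontr)
  assume k1: "k1 s0 \<noteq> 0"
  have "\<exists>E. \<forall>s\<in>I. k s * k2 s + (k1 s)^2 / 2 - (k s)^4 / 2 = E"
  proof (rule has_field_derivative_zero_constant)
    show "convex I" using I(2) by (simp add: is_interval_convex)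
    fix s assume s: "s \<in> I"
    have "((\<lambda>s. k s * k2 s + (k1 s)^2 / 2 - (k s)^4 / 2) has_real_derivative
        k1 s * k2 s + k s * k3 s + k1 s * k2 s - 2 * (k s)^3 * k1 s) (at s)"
      by (auto intro!: derivative_eq_intros d s)
    then show "((\<lambda>s. k s * k2 s + (k1 s)^2 / 2 - (k s)^4 / 2) has_real_derivative 0) (at s within I)"
      by (rule has_field_derivative_at_within[OF DERIV_cong]) (use T[OF s] in simp)
  qed
  then obtain E where E: "\<And>s. s \<in> I \<Longrightarrow> k s * k2 s + (k1 s)^2 / 2 - (k s)^4 / 2 = E" by blast
  define w where "w s = (k s)^4 + (k1 s)^2" for s
  define f where "f s = - 7/2 * (w s)^2 + E * (8 * w s - 18 * (k s)^4) - 2 * E^2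
      + K * (k s)^2 * (E - (k s)^4 - w s/2)" for s
  have f0: "f s = 0" if s: "s \<in> I" for s
  proof -
    have "((\<lambda>s. 2 * k1 s * k2 s + k s * k3 s - 2 * (k s)^3 * k1 s) has_real_derivative
        2 * (k2 s)^2 + 3 * k1 s * k3 s + k s * k4 s - 6 * (k s)^2 * (k1 s)^2 - 2 * (k s)^3 * k2 s) (at s)"
      by (rule derivative_eq_intros d s refl)+ (simp add: algebra_simps power2_eq_square)
    then have T': "2 * (k2 s)^2 + 3 * k1 s * k3 s + k s * k4 s - 6 * (k s)^2 * (k1 s)^2 - 2 * (k s)^3 * k2 s = 0"
      by (rule zero_deriv_of_zero[OF I(1) s, rotated]) (use T in simp)
    \<comment> \<open>This combination of N, of the derivative of T and of T itself cancels
      \<open>k4\<close> and \<open>k3\<close>. The remaining \<open>k2\<close> occurs in the form in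
      which it is absorbed by E.\<close>
    have "f s = (k s)^3 * (k4 s - 10 * (k s)^2 * k2 s - 15 * k s * (k1 s)^2 + (k s)^5 + (k2 s - 2 * (k s)^3) * K)
      - (k s)^2 * (2 * (k2 s)^2 + 3 * k1 s * k3 s + k s * k4 s - 6 * (k s)^2 * (k1 s)^2 - 2 * (k s)^3 * k2 s)
      + 3 * k s * k1 s * (2 * k1 s * k2 s + k s * k3 s - 2 * (k s)^3 * k1 s)"
      unfolding f_def w_def E[OF s, symmetric] by (simp add: field_simps eval_nat_numeral)
    then show ?thesis using T[OF s] N[OF s] T' by simp
  qed
  have G: "k1 s * ((- 7 * w s + 8 * E - K * (k s)^2 / 2) * (6 * (k s)^4 - w s + 2 * E)
      - 72 * E * (k s)^4 + 2 * K * (k s)^2 * E - 6 * K * (k s)^6 - K * (k s)^2 * w s) = 0" if s: "s \<in> I" for s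
  proof -
    let ?w1 = "4 * (k s)^3 * k1 s + 2 * k1 s * k2 s"
    have w1: "(w has_real_derivative ?w1) (at s)" unfolding w_def
      by (rule derivative_eq_intros d s refl)+ simp
    have "(f has_real_derivative (- 7 * w s + 8 * E - K * (k s)^2 / 2) * ?w1
       + k1 s * (- 72 * E * (k s)^3 + 2 * K * k s * E - 6 * K * (k s)^5 - K * k s * w s)) (at s)"
      unfolding f_def by (auto intro!: derivative_eq_intros d s w1 simp: field_simps eval_nat_numeral)
    then have "(- 7 * w s + 8 * E - K * (k s)^2 / 2) * ?w1
       + k1 s * (- 72 * E * (k s)^3 + 2 * K * k s * E - 6 * K * (k s)^5 - K * k s * w s) = 0"
      by (rule zero_deriv_of_zero[OF I(1) s, rotated]) (use f0 in simp)
    \<comment> \<open>The extra factor \<open>k\<close> makes \<open>k * k2\<close> appear in the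
      derivative of \<open>w\<close>. Expressing it through E and \<open>w\<close> leaves
      \<open>k1\<close> as a common factor.\<close>
    then have *: "k s * ((- 7 * w s + 8 * E - K * (k s)^2 / 2) * ?w1
       + k1 s * (- 72 * E * (k s)^3 + 2 * K * k s * E - 6 * K * (k s)^5 - K * k s * w s)) = 0" by simp
    have kw1: "k s * ?w1 = k1 s * (6 * (k s)^4 - w s + 2 * E)"
      unfolding w_def E[OF s, symmetric] by (simp add: field_simps eval_nat_numeral)
    have "k1 s * ((- 7 * w s + 8 * E - K * (k s)^2 / 2) * (6 * (k s)^4 - w s + 2 * E)
      - 72 * E * (k s)^4 + 2 * K * (k s)^2 * E - 6 * K * (k s)^6 - K * (k s)^2 * w s)
      = (- 7 * w s + 8 * E - K * (k s)^2 / 2) * (k1 s * (6 * (k s)^4 - w s + 2 * E))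
       + k s * (k1 s * (- 72 * E * (k s)^3 + 2 * K * k s * E - 6 * K * (k s)^5 - K * k s * w s))"
      by (simp add: algebra_simps eval_nat_numeral)
    also have "\<dots> = 0" unfolding kw1[symmetric] using * by (simp add: algebra_simps)
    finally show ?thesis .
  qed
  \<comment> \<open>For E = K = 0 the eliminant is identically zero. In that case, however,
    \<open>f = 0\<close> reduces to \<open>w = 0\<close>, which contradicts
    \<open>k > 0\<close>.\<close>
  have EK: "E \<noteq> 0 \<or> K \<noteq> 0"
  proof (rule ccontr)
    assume "\<not> ?thesis"
    then have "w s0 = 0" using f0[OF s0] by (simp add: f_def)
    moreover have "w s0 > 0" using pos[OF s0] by (auto simp: w_def intro: add_pos_nonneg)
    ultimately show False by simp
  qed
  have "isCont k1 s0" using d(2)[OF s0] by (rule DERIV_isCont)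
  then obtain r where r: "r > 0" "\<And>t. dist s0 t < r \<Longrightarrow> k1 t \<noteq> 0"
    using continuous_at_avoid[of s0 k1 0] k1 by auto
  obtain r' where r': "r' > 0" "ball s0 r' \<subseteq> I" using I(1) s0 open_contains_ball by blast
  define J where "J = ball s0 (min r r')"
  have J: "J \<subseteq> I" "\<And>t. t \<in> J \<Longrightarrow> k1 t \<noteq> 0" "open J" "connected J" "s0 \<in> J"
    using r r' by (auto simp: J_def)
  have "(\<lambda>s. (k s)^2) constant_on J"
  proof (rule continuous_finite_range_constant[OF J(4)])
    show "continuous_on J (\<lambda>s. (k s)^2)"
      using d(1) J(1)
      by (intro continuous_on_power continuous_at_imp_continuous_on) (blast dest: DERIV_isCont)
    have "(\<lambda>s. (k s)^2) ` J \<subseteq> {v. curvature_eliminant E K v = 0}"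
    proof (intro image_subsetI CollectI)
      fix s assume "s \<in> J"
      then have s: "s \<in> I" "k1 s \<noteq> 0" using J by auto
      have p: "(k s)^4 = ((k s)^2)^2" "(k s)^6 = ((k s)^2)^3" by simp_all
      show "curvature_eliminant E K ((k s)^2) = 0"
        by (rule curvature_eliminant_eq_0[of "w s"])
          (use f0[OF s(1), unfolded f_def p] G[OF s(1), unfolded p] s(2) in simp_all)
    qed
    then show "finite ((\<lambda>s. (k s)^2) ` J)"
      using finite_roots_curvature_eliminant[OF EK] finite_subset by blast
  qed
  then obtain C where C: "\<And>s. s \<in> J \<Longrightarrow> (k s)^2 - C = 0" by (auto simp: constant_on_def)
  have "((\<lambda>s. (k s)^2 - C) has_real_derivative 2 * k s0 * k1 s0) (at s0)"
    by (auto intro!: derivative_eq_intros d s0)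
  then have "2 * k s0 * k1 s0 = 0"
    by (rule zero_deriv_of_zero[OF J(3,5), rotated]) (use C in simp)
  then show False using pos[OF s0] k1 by simp
qed

section \<open>Regularity and covariant derivatives along curves\<close>

text \<open>n-fold differentiability on \<open>I\<close>, with the derivatives given by witnesses
  that matter only on \<open>I\<close>. This form makes closure under sums, products, inverses and
  roots a plain induction on n, with no computation of iterated \<open>deriv\<close>.\<close>

primrec ndiff :: "real set \<Rightarrow> nat \<Rightarrow> (real \<Rightarrow> real) \<Rightarrow> bool" where
  "ndiff I 0 f \<longleftrightarrow> True"
| "ndiff I (Suc n) f \<longleftrightarrow> (\<exists>f'. (\<forall>s\<in>I. (f has_real_derivative f' s) (at s)) \<and> ndiff I n f')"

lemma ndiff_Suc_D: "ndiff I (Suc n) f \<Longrightarrow> ndiff I n f"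
  by (induction n arbitrary: f) auto

lemma ndiff_const: "ndiff I n (\<lambda>_. c)"
  by (induction n arbitrary: c) (auto intro!: exI[of _ "\<lambda>_. 0"])

lemma ndiff_add: "ndiff I n f \<Longrightarrow> ndiff I n g \<Longrightarrow> ndiff I n (\<lambda>s. f s + g s)"
proof (induction n arbitrary: f g)
  case (Suc n)
  then obtain f' g' where "\<forall>s\<in>I. (f has_real_derivative f' s) (at s)" "ndiff I n f'"
    "\<forall>s\<in>I. (g has_real_derivative g' s) (at s)" "ndiff I n g'" by auto
  then show ?case using Suc.IH[of f' g']
    by (auto intro!: exI[of _ "\<lambda>s. f' s + g' s"] derivative_intros)
qed simp

lemma ndiff_mult: "ndiff I n f \<Longrightarrow> ndiff I n g \<Longrightarrow> ndiff I n (\<lambda>s. f s * g s)"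
proof (induction n arbitrary: f g)
  case (Suc n)
  then obtain f' g' where *: "\<forall>s\<in>I. (f has_real_derivative f' s) (at s)" "ndiff I n f'"
    "\<forall>s\<in>I. (g has_real_derivative g' s) (at s)" "ndiff I n g'" by auto
  have "ndiff I n (\<lambda>s. f' s * g s + g' s * f s)"
    using * Suc.prems by (intro ndiff_add Suc.IH) (auto dest: ndiff_Suc_D simp del: ndiff.simps)
  then show ?case using *
    by (auto intro!: exI[of _ "\<lambda>s. f' s * g s + g' s * f s"] DERIV_mult)
qed simp

lemma ndiff_cmult: "ndiff I n f \<Longrightarrow> ndiff I n (\<lambda>s. c * f s)"
  by (intro ndiff_mult ndiff_const)

lemma ndiff_minus: "ndiff I n f \<Longrightarrow> ndiff I n (\<lambda>s. - f s)"
  using ndiff_cmult[of I n f "-1"] by simp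

lemma ndiff_diff: "ndiff I n f \<Longrightarrow> ndiff I n g \<Longrightarrow> ndiff I n (\<lambda>s. f s - g s)"
  using ndiff_add[of I n f "\<lambda>s. - g s"] ndiff_minus by simp

lemma ndiff_power: "ndiff I n f \<Longrightarrow> ndiff I n (\<lambda>s. f s ^ m)"
  by (induction m) (auto intro: ndiff_const ndiff_mult)

text \<open>The derivative is a product of \<open>f'\<close> with copies of the inverse itself,
  whose regularity of one order less is the induction hypothesis. The square root below is treated
  in the same way.\<close>

lemma ndiff_inverse:
  assumes "\<And>s. s \<in> I \<Longrightarrow> f s \<noteq> 0"
  shows "ndiff I n f \<Longrightarrow> ndiff I n (\<lambda>s. inverse (f s))"
proof (induction n)
  case (Suc n)
  then obtain f' where *: "\<forall>s\<in>I. (f has_real_derivative f' s) (at s)" "ndiff I n f'" by auto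
  have "ndiff I n (\<lambda>s. - (inverse (f s) * f' s * inverse (f s)))"
    using * Suc by (intro ndiff_minus ndiff_mult Suc.IH) (auto dest: ndiff_Suc_D simp del: ndiff.simps)
  then show ?case using * assms
    by (auto intro!: exI[of _ "\<lambda>s. - (inverse (f s) * f' s * inverse (f s))"] DERIV_inverse')
qed simp

lemma ndiff_sqrt:
  assumes "\<And>s. s \<in> I \<Longrightarrow> f s > 0"
  shows "ndiff I n f \<Longrightarrow> ndiff I n (\<lambda>s. sqrt (f s))"
proof (induction n)
  case (Suc n)
  then obtain f' where *: "\<forall>s\<in>I. (f has_real_derivative f' s) (at s)" "ndiff I n f'" by auto
  have "ndiff I n (\<lambda>s. sqrt (f s))"
    using Suc by (auto dest: ndiff_Suc_D simp del: ndiff.simps)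
  then have "ndiff I n (\<lambda>s. inverse (sqrt (f s)))"
    using assms by (intro ndiff_inverse) (auto simp: less_imp_neq[symmetric])
  then have "ndiff I n (\<lambda>s. inverse (sqrt (f s)) / 2 * f' s)"
    using *(2) ndiff_cmult[of I n "\<lambda>s. inverse (sqrt (f s))" "1/2"] by (intro ndiff_mult) simp_all
  then show ?case using * assms
    by (auto intro!: exI[of _ "\<lambda>s. inverse (sqrt (f s)) / 2 * f' s"] DERIV_chain2[OF DERIV_real_sqrt])
qed simp

lemma ndiff_if: "(P \<Longrightarrow> ndiff I n f) \<Longrightarrow> (\<not> P \<Longrightarrow> ndiff I n g) \<Longrightarrow> ndiff I n (\<lambda>s. if P then f s else g s)"
  by (cases P) simp_all

lemma ndiff_cong:
  assumes "open I" "\<And>s. s \<in> I \<Longrightarrow> f s = g s" "ndiff I n f"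
  shows "ndiff I n g"
proof (cases n)
  case (Suc m)
  then obtain f' where *: "\<forall>s\<in>I. (f has_real_derivative f' s) (at s)" "ndiff I m f'"
    using assms(3) by auto
  have "(g has_real_derivative f' s) (at s)" if "s \<in> I" for s
    by (rule has_field_derivative_transform_within_open[of f _ _ I]) (use assms * that in auto)
  then show ?thesis using * Suc by auto
qed simp

lemma ndiff_iterated_deriv:
  assumes "\<And>m s. s \<in> I \<Longrightarrow> (deriv ^^ m) f differentiable at s"
  shows "ndiff I n ((deriv ^^ m) f)"
proof (induction n arbitrary: m)
  case (Suc n)
  have "((deriv ^^ m) f has_real_derivative (deriv ^^ Suc m) f s) (at s)" if "s \<in> I" for s
    using assms[OF that, of m] by (simp add: DERIV_deriv_iff_real_differentiable)
  then show ?case using Suc.IH[of "Suc m"] unfolding ndiff.simps by blast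
qed simp

lemmas ndiff_intros = ndiff_const ndiff_add ndiff_mult ndiff_minus ndiff_diff ndiff_power ndiff_if

section \<open>Regularity and Leibniz rules along a smooth curve in the domain\<close>

context
  fixes a b :: real and I :: "real set" and c :: "real \<Rightarrow> real^3"
  assumes I: "open I" and dom: "\<forall>s\<in>I. c s \<in> bcv_domain a" and smooth: "smooth_curve I c"
begin

lemma curve_deriv:
  assumes "s \<in> I"
  shows "((\<lambda>t. c t $ i) has_real_derivative vel c s $ i) (at s)"
proof -
  have "((deriv ^^ 0) (\<lambda>t. c t $ i)) differentiable (at s)"
    using smooth assms unfolding smooth_curve_def by blast
  then show ?thesis by (simp add: vel_def DERIV_deriv_iff_real_differentiable)
qed

lemma ndiff_curve: "ndiff I n (\<lambda>t. c t $ i)"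
  using ndiff_iterated_deriv[where m = 0 and f = "\<lambda>t. c t $ i"] smooth by (simp add: smooth_curve_def)

lemma ndiff_vel: "ndiff I n (\<lambda>t. vel c t $ i)"
  using ndiff_iterated_deriv[where m = 1 and f = "\<lambda>t. c t $ i"] smooth by (simp add: smooth_curve_def vel_def)

lemma ndiff_acc: "ndiff I n (\<lambda>t. deriv (\<lambda>t. vel c t $ i) t)"
  using ndiff_iterated_deriv[where m = 2 and f = "\<lambda>t. c t $ i"] smooth
  by (simp add: smooth_curve_def vel_def eval_nat_numeral)

lemma ndiff_rlam: "ndiff I n (\<lambda>s. rlam a (c s))"
  unfolding rlam_def bcv_lambda_def using dom
  by (intro ndiff_inverse ndiff_intros ndiff_curve) (fastforce simp: bcv_domain_def bcv_lambda_def)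

lemma ndiff_covD_vel: "ndiff I n (\<lambda>s. covD a b c (vel c) s $ k)"
proof -
  have bcv_christoffel: "ndiff I n (\<lambda>s. bcv_christoffel a b k i j (c s))" for i j
    unfolding bcv_christoffel_def christoffel_table_def Let_def by (intro ndiff_intros ndiff_rlam ndiff_curve)
  have "ndiff I n (\<lambda>s. deriv (\<lambda>t. vel c t $ k) s
      + (\<Sum>i\<in>UNIV. \<Sum>j\<in>UNIV. bcv_christoffel a b k i j (c s) * vel c s $ i * vel c s $ j))"
    unfolding sum_3 by (intro ndiff_intros ndiff_acc bcv_christoffel ndiff_vel)
  then show ?thesis
    by (rule ndiff_cong[OF I, rotated]) (use dom in \<open>simp add: covD_def christoffel_eq\<close>)
qed

lemma ndiff_g_inner:
  assumes "\<And>i. ndiff I n (\<lambda>s. V s $ i)" "\<And>i. ndiff I n (\<lambda>s. W s $ i)"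
  shows "ndiff I n (\<lambda>s. g_inner a b (c s) (V s) (W s))"
proof -
  have om: "ndiff I n (\<lambda>s. bcv_form a b (c s) $ i)" for i
    using exhaust_3[of i]
    by (elim disjE; simp only: bcv_form_simps; intro ndiff_intros ndiff_rlam ndiff_curve)
  show ?thesis
    unfolding g_inner_def bcv_g_nth sum_3 by (intro ndiff_intros om assms ndiff_rlam)
qed

lemma covD_nth:
  assumes "s \<in> I" "\<And>k. ((\<lambda>t. V t $ k) has_real_derivative D k) (at s)"
  shows "covD a b c V s $ k = D k + (\<Sum>i\<in>UNIV. \<Sum>j\<in>UNIV. bcv_christoffel a b k i j (c s) * vel c s $ i * V s $ j)"
  using DERIV_imp_deriv[OF assms(2)] dom assms(1) by (simp add: covD_def christoffel_eq)

text \<open>Leibniz rule. Since \<open>covD\<close> at s depends on V only near s, the decomposition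
  of V is required on the open set \<open>I\<close> alone.\<close>

lemma covD_combination:
  assumes s: "s \<in> I" and V: "\<And>t. t \<in> I \<Longrightarrow> V t = f t *\<^sub>R X t + h t *\<^sub>R Y t"
    and f: "(f has_real_derivative f') (at s)" and h: "(h has_real_derivative h') (at s)"
    and X: "\<And>k. (\<lambda>t. X t $ k) differentiable (at s)" and Y: "\<And>k. (\<lambda>t. Y t $ k) differentiable (at s)"
  shows "covD a b c V s = f' *\<^sub>R X s + f s *\<^sub>R covD a b c X s + h' *\<^sub>R Y s + h s *\<^sub>R covD a b c Y s"
proof -
  define DX DY where "DX k = deriv (\<lambda>t. X t $ k) s" and "DY k = deriv (\<lambda>t. Y t $ k) s" for k
  have DX: "((\<lambda>t. X t $ k) has_real_derivative DX k) (at s)" for k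
    using X by (simp add: DX_def DERIV_deriv_iff_real_differentiable)
  have DY: "((\<lambda>t. Y t $ k) has_real_derivative DY k) (at s)" for k
    using Y by (simp add: DY_def DERIV_deriv_iff_real_differentiable)
  have "((\<lambda>t. V t $ k) has_real_derivative f' * X s $ k + DX k * f s + (h' * Y s $ k + DY k * h s)) (at s)" for k
  proof (rule has_field_derivative_transform_within_open[OF _ I s])
    show "((\<lambda>t. f t * X t $ k + h t * Y t $ k) has_real_derivative f' * X s $ k + DX k * f s + (h' * Y s $ k + DY k * h s)) (at s)"
      by (intro DERIV_add DERIV_mult f h DX DY)
  qed (simp add: V)
  note DV = this
  show ?thesis
    using V[OF s] by (simp add: vec_eq_iff covD_nth[OF s DV] covD_nth[OF s DX] covD_nth[OF s DY]
      sum_3 algebra_simps)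
qed

text \<open>Metric compatibility for the inner product of V with E3. The correction term is the
  inner product of V with the covariant derivative of E3 along the curve. For V = B it yields the
  derivative b/2 times the vertical component of N.\<close>

lemma vertical_component_deriv:
  assumes s: "s \<in> I" and V: "\<And>k. (\<lambda>t. V t $ k) differentiable (at s)"
  defines "T \<equiv> coframe a b (c s) (vel c s)" and "v \<equiv> coframe a b (c s) (V s)"
  shows "((\<lambda>t. bcv_form a b (c t) \<bullet> V t) has_real_derivative
    bcv_form a b (c s) \<bullet> covD a b c V s - b/2 * (T$1 * v$2 - T$2 * v$1)) (at s)"
proof -
  define DV where "DV k = deriv (\<lambda>t. V t $ k) s" for k
  have DV: "((\<lambda>t. V t $ k) has_real_derivative DV k) (at s)" for k
    using V by (simp add: DV_def DERIV_deriv_iff_real_differentiable)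
  have r: "(1 + a * ((c s$1)^2 + (c s$2)^2)) * rlam a (c s) = 1"
    using s dom by (intro rlam_mult) blast
  then have r2: "rlam a (c s) = (1 + a * ((c s$1)^2 + (c s$2)^2)) * (rlam a (c s))^2"
    by algebra
  have r0: "1 + a * ((c s$1)^2 + (c s$2)^2) \<noteq> 0" using r by auto
  define L' where "L' = - 2 * a * (c s $ 1 * vel c s $ 1 + c s $ 2 * vel c s $ 2) * (rlam a (c s))^2"
  have L': "((\<lambda>t. rlam a (c t)) has_real_derivative L') (at s)"
    unfolding rlam_def bcv_lambda_def L'_def using r0
    by (auto intro!: derivative_eq_intros curve_deriv s simp: field_simps power2_eq_square)
  obtain \<beta> where b: "b = 2 * \<beta>" by (metis mult.commute nonzero_eq_divide_eq zero_neq_numeral)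
  have w: "(\<lambda>t. bcv_form a b (c t) \<bullet> V t) = (\<lambda>t. \<beta> * (c t $ 2 * rlam a (c t)) * V t $ 1
      - \<beta> * (c t $ 1 * rlam a (c t)) * V t $ 2 + V t $ 3)"
    by (simp add: b inner_vec_def sum_3 algebra_simps)
  have "((\<lambda>t. \<beta> * (c t $ 2 * rlam a (c t)) * V t $ 1
      - \<beta> * (c t $ 1 * rlam a (c t)) * V t $ 2 + V t $ 3) has_real_derivative
     \<beta> * (vel c s $ 2 * rlam a (c s) + L' * c s $ 2) * V s $ 1 + DV 1 * (\<beta> * (c s $ 2 * rlam a (c s)))
     - (\<beta> * (vel c s $ 1 * rlam a (c s) + L' * c s $ 1) * V s $ 2 + DV 2 * (\<beta> * (c s $ 1 * rlam a (c s)))) + DV 3) (at s)"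
    by (intro DERIV_add DERIV_diff DERIV_mult DERIV_cmult DV L' curve_deriv s)
  moreover have "\<beta> * (vel c s $ 2 * rlam a (c s) + L' * c s $ 2) * V s $ 1 + DV 1 * (\<beta> * (c s $ 2 * rlam a (c s)))
     - (\<beta> * (vel c s $ 1 * rlam a (c s) + L' * c s $ 1) * V s $ 2 + DV 2 * (\<beta> * (c s $ 1 * rlam a (c s)))) + DV 3
     = bcv_form a b (c s) \<bullet> covD a b c V s - b/2 * (T$1 * v$2 - T$2 * v$1)"
  proof -
    \<comment> \<open>This raises the terms from differentiating the coordinates to degree 2 in
      \<open>rlam\<close>, the degree of \<open>L'\<close>; the claim then becomes a ring
      identity.\<close>
    have 1: "vel c s $ i * rlam a (c s) = vel c s $ i * (1 + a * ((c s$1)^2 + (c s$2)^2)) * (rlam a (c s))^2" for i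
      by (subst r2) simp
    show ?thesis unfolding 1 inner_vec_def sum_3 covD_nth[OF s DV]
      by (simp add: inner_vec_def sum_3 T_def v_def coframe_simps bcv_christoffel_def christoffel_table_def Let_def
        doubleton_eq_iff L'_def b) algebra
  qed
  ultimately show ?thesis unfolding w by simp
qed

end

section \<open>Triharmonic curves without torsion\<close>

text \<open>The vectors t, n, u form a positively oriented orthonormal basis. The first claim is the
  third component of t \<times> u = -n, the second expands the unit vector along the third axis in
  this basis.\<close>

lemma cross3_orthonormal:
  fixes t n :: "real^3"
  assumes "t \<bullet> t = 1" "n \<bullet> n = 1" "n \<bullet> t = 0"
  defines "u \<equiv> cross3 t n"
  shows "t$1 * u$2 - t$2 * u$1 = - n$3"
    and "(t$3)^2 + (n$3)^2 + (u$3)^2 = 1"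
    and "u \<bullet> u = 1" "t \<bullet> u = 0" "n \<bullet> u = 0"
proof -
  have o: "t$1 * t$1 + t$2 * t$2 + t$3 * t$3 = 1" "n$1 * n$1 + n$2 * n$2 + n$3 * n$3 = 1"
    "n$1 * t$1 + n$2 * t$2 + n$3 * t$3 = 0"
    using assms(1-3) by (simp_all add: inner_vec_def sum_3)
  have u: "u$1 = t$2 * n$3 - t$3 * n$2" "u$2 = t$3 * n$1 - t$1 * n$3" "u$3 = t$1 * n$2 - t$2 * n$1"
    by (simp_all add: u_def cross3_def)
  show "t$1 * u$2 - t$2 * u$1 = - n$3" unfolding u using o by algebra
  have "(u$3)^2 = (t$1 * t$1 + t$2 * t$2) * (n$1 * n$1 + n$2 * n$2) - (n$1 * t$1 + n$2 * t$2)^2"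
    unfolding u by algebra
  also have "\<dots> = (1 - (t$3)^2) * (1 - (n$3)^2) - (n$3 * t$3)^2"
  proof -
    have "t$1 * t$1 + t$2 * t$2 = 1 - (t$3)^2" "n$1 * n$1 + n$2 * n$2 = 1 - (n$3)^2"
      "n$1 * t$1 + n$2 * t$2 = - (n$3 * t$3)"
      using o by (simp_all add: power2_eq_square)
    then show ?thesis by (simp only: power2_minus)
  qed
  finally show "(t$3)^2 + (n$3)^2 + (u$3)^2 = 1" by (simp add: algebra_simps power2_eq_square)
  have "u \<bullet> u = (t \<bullet> t) * (n \<bullet> n) - (n \<bullet> t)^2"
    unfolding inner_vec_def sum_3 u inner_real_def by algebra
  then show "u \<bullet> u = 1" using assms(1-3) by simp
  show "t \<bullet> u = 0" "n \<bullet> u = 0"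
    by (simp_all add: u_def dot_cross_self)
qed

text \<open>\<open>Q\<close> is R(N,T)T. By skew-symmetry only the N-part of the first argument
  survives against T, and only its T-part survives against N, with reversed sign.\<close>

lemma curv_orthonormal:
  assumes p: "p \<in> bcv_domain a"
    and o: "g_inner a b p T T = 1" "g_inner a b p N T = 0"
  defines "t \<equiv> bcv_form a b p \<bullet> T" and "n \<equiv> bcv_form a b p \<bullet> N"
  defines "Q \<equiv> (4 * a - 3 * (b/2)^2) *\<^sub>R N
    - (4 * a - b^2) *\<^sub>R (t^2 *\<^sub>R N - (n * t) *\<^sub>R T + n *\<^sub>R axis 3 1)"
  shows "curv a b p (\<alpha> *\<^sub>R T + \<beta> *\<^sub>R N) T T = \<beta> *\<^sub>R Q"
    and "curv a b p (\<alpha> *\<^sub>R T + \<beta> *\<^sub>R N) (\<kappa> *\<^sub>R N) T = - (\<alpha> * \<kappa>) *\<^sub>R Q"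
proof -
  have o': "coframe a b p T \<bullet> coframe a b p T = 1" "coframe a b p N \<bullet> coframe a b p T = 0"
    using o by (simp_all add: g_inner_coframe)
  show "curv a b p (\<alpha> *\<^sub>R T + \<beta> *\<^sub>R N) T T = \<beta> *\<^sub>R Q"
    unfolding curv_eq[OF p] Let_def Q_def t_def n_def
    by (simp add: vec_eq_iff g_inner_coframe coframe_linear inner_simps o' algebra_simps power2_eq_square)
  show "curv a b p (\<alpha> *\<^sub>R T + \<beta> *\<^sub>R N) (\<kappa> *\<^sub>R N) T = - (\<alpha> * \<kappa>) *\<^sub>R Q"
    unfolding curv_eq[OF p] Let_def Q_def t_def n_def
    by (simp add: vec_eq_iff g_inner_coframe coframe_linear inner_simps o' algebra_simps power2_eq_square)
qed

text \<open>\<open>frenet\<close> states no regularity of \<kappa>. It is recovered from the curve,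
  since \<kappa> is the length of the covariant derivative of the velocity and the radicand is
  positive.\<close>

lemma frenet_curvature_smooth:
  assumes I: "open I" and dom: "\<forall>s\<in>I. c s \<in> bcv_domain a" and smooth: "smooth_curve I c"
    and F: "frenet a b I c \<kappa> N B \<tau>"
  shows "ndiff I n \<kappa>"
proof -
  have F': "\<kappa> s > 0" "g_inner a b (c s) (N s) (N s) = 1" "covD a b c (vel c) s = \<kappa> s *\<^sub>R N s" if "s \<in> I" for s
    using F that by (auto simp: frenet_def)
  define h where "h s = g_inner a b (c s) (covD a b c (vel c) s) (covD a b c (vel c) s)" for s
  have h: "h s = (\<kappa> s)^2" if "s \<in> I" for s
    using F'[OF that] by (simp add: h_def g_inner_coframe coframe_linear power2_eq_square)
  have "ndiff I n h"
    unfolding h_def using I dom smooth by (intro ndiff_g_inner ndiff_covD_vel)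
  then have "ndiff I n (\<lambda>s. sqrt (h s))"
    by (rule ndiff_sqrt[rotated]) (use h F'(1) in force)
  then show ?thesis
    by (rule ndiff_cong[OF I, rotated]) (use h F'(1) in \<open>simp add: less_imp_le\<close>)
qed

text \<open>The three conclusions are the components of the triharmonic equation along T, N and B,
  where \<open>k1\<close> to \<open>k4\<close> are the successive derivatives of \<kappa>.\<close>

lemma triharmonic_frenet_equations:
  assumes I: "open I" and dom: "\<forall>s\<in>I. c s \<in> bcv_domain a" and smooth: "smooth_curve I c"
    and unit: "unit_speed a b I c" and tri: "triharmonic a b I c"
    and F: "frenet a b I c \<kappa> N B (\<lambda>_. 0)"
    and d: "\<And>s. s \<in> I \<Longrightarrow> (\<kappa> has_real_derivative k1 s) (at s)"
      "\<And>s. s \<in> I \<Longrightarrow> (k1 has_real_derivative k2 s) (at s)"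
      "\<And>s. s \<in> I \<Longrightarrow> (k2 has_real_derivative k3 s) (at s)"
      "\<And>s. s \<in> I \<Longrightarrow> (k3 has_real_derivative k4 s) (at s)"
    and s: "s \<in> I"
  defines "n3 \<equiv> bcv_form a b (c s) \<bullet> N s" and "b3 \<equiv> bcv_form a b (c s) \<bullet> B s"
  shows "2 * k1 s * k2 s + \<kappa> s * k3 s = 2 * (\<kappa> s)^3 * k1 s"
    and "k4 s - 10 * (\<kappa> s)^2 * k2 s - 15 * \<kappa> s * (k1 s)^2 + (\<kappa> s)^5
      + (k2 s - 2 * (\<kappa> s)^3) * (b^2 / 4 + (4 * a - b^2) * b3^2) = 0"
    and "(k2 s - 2 * (\<kappa> s)^3) * ((4 * a - b^2) * (n3 * b3)) = 0"
proof -
  let ?T = "vel c"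
  have N: "covD a b c ?T s = \<kappa> s *\<^sub>R N s" "covD a b c N s = - \<kappa> s *\<^sub>R ?T s" if "s \<in> I" for s
    using F that by (auto simp: frenet_def)
  have dN: "(\<lambda>t. N t $ k) differentiable (at s)" if "s \<in> I" for s k
    using F that by (auto simp: frenet_def)
  have dT: "(\<lambda>t. vel c t $ k) differentiable (at s)" if "s \<in> I" for s k
    using ndiff_vel[OF I dom smooth, of 1 k] that by (auto simp: real_differentiable_def)
  have step: "covD a b c V s = (f1 - \<kappa> s * h s) *\<^sub>R ?T s + (h1 + \<kappa> s * f s) *\<^sub>R N s"
    if "\<And>s. s \<in> I \<Longrightarrow> V s = f s *\<^sub>R ?T s + h s *\<^sub>R N s" "s \<in> I"
      "(f has_real_derivative f1) (at s)" "(h has_real_derivative h1) (at s)" for V f h f1 h1 s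
    using covD_combination[OF I dom smooth that(2,1,3,4) dT[OF that(2)] dN[OF that(2)]] N[OF that(2)]
    by (simp add: algebra_simps)
  have c1: "(covD a b c ^^ 1) ?T s = 0 *\<^sub>R ?T s + \<kappa> s *\<^sub>R N s" if "s \<in> I" for s
    using N that by simp
  have c2: "(covD a b c ^^ 2) ?T s = (- ((\<kappa> s)^2)) *\<^sub>R ?T s + k1 s *\<^sub>R N s" if "s \<in> I" for s
    using step[OF c1 that DERIV_const d(1)[OF that]] that by (simp add: eval_nat_numeral)
  have c3: "(covD a b c ^^ 3) ?T s = (- 3 * \<kappa> s * k1 s) *\<^sub>R ?T s + (k2 s - (\<kappa> s)^3) *\<^sub>R N s" if "s \<in> I" for s
  proof -
    have "((\<lambda>s. - ((\<kappa> s)^2)) has_real_derivative - (2 * \<kappa> s * k1 s)) (at s)"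
      by (auto intro!: derivative_eq_intros d that)
    from step[OF c2 that this d(2)[OF that]] show ?thesis
      by (simp add: eval_nat_numeral algebra_simps)
  qed
  have c4: "(covD a b c ^^ 4) ?T s = (- 3 * (k1 s)^2 - 4 * \<kappa> s * k2 s + (\<kappa> s)^4) *\<^sub>R ?T s
      + (k3 s - 6 * (\<kappa> s)^2 * k1 s) *\<^sub>R N s" if "s \<in> I" for s
  proof -
    have "((\<lambda>s. - 3 * \<kappa> s * k1 s) has_real_derivative - 3 * (k1 s)^2 - 3 * \<kappa> s * k2 s) (at s)"
      "((\<lambda>s. k2 s - (\<kappa> s)^3) has_real_derivative k3 s - 3 * (\<kappa> s)^2 * k1 s) (at s)"
      by (auto intro!: derivative_eq_intros d that simp: algebra_simps power2_eq_square)
    from step[OF c3 that this] show ?thesis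
      by (simp add: eval_nat_numeral algebra_simps)
  qed
  have c5: "(covD a b c ^^ 5) ?T s = (- 10 * k1 s * k2 s - 5 * \<kappa> s * k3 s + 10 * (\<kappa> s)^3 * k1 s) *\<^sub>R ?T s
      + (k4 s - 10 * (\<kappa> s)^2 * k2 s - 15 * \<kappa> s * (k1 s)^2 + (\<kappa> s)^5) *\<^sub>R N s"
  proof -
    have "((\<lambda>s. - 3 * (k1 s)^2 - 4 * \<kappa> s * k2 s + (\<kappa> s)^4) has_real_derivative
        - 10 * k1 s * k2 s - 4 * \<kappa> s * k3 s + 4 * (\<kappa> s)^3 * k1 s) (at s)"
      "((\<lambda>s. k3 s - 6 * (\<kappa> s)^2 * k1 s) has_real_derivative k4 s - 12 * \<kappa> s * (k1 s)^2 - 6 * (\<kappa> s)^2 * k2 s) (at s)"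
      by (auto intro!: derivative_eq_intros d s simp: algebra_simps power2_eq_square)
    from step[OF c4 s this] show ?thesis
      by (simp add: eval_nat_numeral algebra_simps)
  qed
  let ?\<phi> = "coframe a b (c s)"
  define t n u where "t = ?\<phi> (?T s)" and "n = ?\<phi> (N s)" and "u = ?\<phi> (B s)"
  have p: "c s \<in> bcv_domain a" using dom s by blast
  have o: "g_inner a b (c s) (?T s) (?T s) = 1" "g_inner a b (c s) (N s) (?T s) = 0"
    "g_inner a b (c s) (N s) (N s) = 1"
    using F unit s by (auto simp: frenet_def unit_speed_def)
  have u: "u = cross3 t n"
    using F s by (auto simp: frenet_def u_def t_def n_def coframe_cross[OF p])
  have on: "t \<bullet> t = 1" "n \<bullet> n = 1" "n \<bullet> t = 0"
    using o by (simp_all add: g_inner_coframe t_def n_def)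
  note un = cross3_orthonormal[OF on, folded u]
  have ne: "n3 = n$3" "b3 = u$3" "bcv_form a b (c s) \<bullet> ?T s = t$3"
    by (simp_all add: n3_def b3_def n_def u_def t_def coframe_simps)
  define P R where "P = - 10 * k1 s * k2 s - 5 * \<kappa> s * k3 s + 10 * (\<kappa> s)^3 * k1 s"
    and "R = k4 s - 10 * (\<kappa> s)^2 * k2 s - 15 * \<kappa> s * (k1 s)^2 + (\<kappa> s)^5"
  define Q where "Q = (4 * a - 3 * (b/2)^2) *\<^sub>R N s
    - (4 * a - b^2) *\<^sub>R ((t$3)^2 *\<^sub>R N s - (n$3 * t$3) *\<^sub>R ?T s + n$3 *\<^sub>R axis 3 1)"
  have "(covD a b c ^^ 5) ?T s
     + curv a b (c s) ((covD a b c ^^ 3) ?T s) (?T s) (?T s)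
     - curv a b (c s) ((covD a b c ^^ 2) ?T s) (covD a b c ?T s) (?T s) = 0"
    using tri s by (simp add: triharmonic_def)
  then have "P *\<^sub>R ?T s + R *\<^sub>R N s + (k2 s - (\<kappa> s)^3) *\<^sub>R Q - (- (- ((\<kappa> s)^2) * \<kappa> s)) *\<^sub>R Q = 0"
    unfolding c5 c3[OF s] c2[OF s] N(1)[OF s] curv_orthonormal[OF p o(1,2)] ne(3)
      ne(1)[unfolded n3_def] Q_def[symmetric] P_def[symmetric] R_def[symmetric] .
  then have "P *\<^sub>R ?T s + R *\<^sub>R N s + (k2 s - 2 * (\<kappa> s)^3) *\<^sub>R Q = 0"
    by (simp add: algebra_simps eval_nat_numeral flip: scaleR_add_left)
  then have "?\<phi> (P *\<^sub>R ?T s + R *\<^sub>R N s + (k2 s - 2 * (\<kappa> s)^3) *\<^sub>R Q) = 0"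
    by (simp add: coframe_linear)
  then have E: "P *\<^sub>R t + R *\<^sub>R n + (k2 s - 2 * (\<kappa> s)^3) *\<^sub>R q = 0" if "q = ?\<phi> Q" for q
    using that by (simp add: coframe_linear t_def n_def)
  define q where "q = ?\<phi> Q"
  have q: "q = (4 * a - 3 * (b/2)^2) *\<^sub>R n
    - (4 * a - b^2) *\<^sub>R ((t$3)^2 *\<^sub>R n - (n$3 * t$3) *\<^sub>R t + n$3 *\<^sub>R axis 3 1)"
    by (simp add: q_def Q_def coframe_linear coframe_axis_3 t_def n_def)
  have ax: "axis 3 1 \<bullet> v = v$3" for v :: "real^3" by (simp add: inner_axis inner_commute)
  have tn: "t \<bullet> n = 0" using on by (simp add: inner_commute)
  \<comment> \<open>The component of R(N,T)T along T vanishes, the one along N is the sectional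
    curvature of the plane of T and N, and the one along B comes only from the E3 term.\<close>
  have qt: "q \<bullet> t = 0" unfolding q by (simp add: inner_simps on ax)
  have qn: "q \<bullet> n = b^2 / 4 + (4 * a - b^2) * b3^2"
  proof -
    have "q \<bullet> n = 4 * a - 3 * (b/2)^2 - (4 * a - b^2) * ((t$3)^2 + (n$3)^2)"
      unfolding q by (simp add: inner_simps on tn ax power2_eq_square)
    also have "(t$3)^2 + (n$3)^2 = 1 - b3^2" using un(2) ne by simp
    finally show ?thesis by (simp add: field_simps power2_eq_square)
  qed
  have qu: "q \<bullet> u = - ((4 * a - b^2) * (n3 * b3))"
    unfolding q ne by (simp add: inner_simps un ax)
  have E': "P * (t \<bullet> v) + R * (n \<bullet> v) + (k2 s - 2 * (\<kappa> s)^3) * (q \<bullet> v) = 0" for v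
  proof -
    have "(P *\<^sub>R t + R *\<^sub>R n + (k2 s - 2 * (\<kappa> s)^3) *\<^sub>R q) \<bullet> v = 0"
      using E[OF q_def] by simp
    then show ?thesis by (simp add: inner_simps)
  qed
  have "P = 0" using E'[of t] by (simp add: on qt)
  then show "2 * k1 s * k2 s + \<kappa> s * k3 s = 2 * (\<kappa> s)^3 * k1 s" by (simp add: P_def)
  show "k4 s - 10 * (\<kappa> s)^2 * k2 s - 15 * \<kappa> s * (k1 s)^2 + (\<kappa> s)^5
      + (k2 s - 2 * (\<kappa> s)^3) * (b^2 / 4 + (4 * a - b^2) * b3^2) = 0"
    using E'[of n] by (simp add: on tn qn R_def)
  show "(k2 s - 2 * (\<kappa> s)^3) * ((4 * a - b^2) * (n3 * b3)) = 0"
    using E'[of u] by (simp add: un qu)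
qed

lemma triharmonic_frenet_constant:
  assumes ab: "4 * a \<noteq> b^2"
    and I: "open I" "is_interval I" and dom: "\<forall>s\<in>I. c s \<in> bcv_domain a"
    and smooth: "smooth_curve I c"
    and unit: "unit_speed a b I c" and tri: "triharmonic a b I c"
    and F: "frenet a b I c \<kappa> N B (\<lambda>_. 0)"
  shows "\<exists>b3. \<forall>s\<in>I. bcv_form a b (c s) \<bullet> B s = b3"
    and "\<And>s. s \<in> I \<Longrightarrow> b * (bcv_form a b (c s) \<bullet> N s) = 0"
    and "\<And>s. s \<in> I \<Longrightarrow> (\<kappa> s)^2 = 2 * (b^2 / 4 + (4 * a - b^2) * (bcv_form a b (c s) \<bullet> B s)^2)"
    and "\<exists>k. \<forall>s\<in>I. \<kappa> s = k"
proof -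
  have conv: "convex I" using I(2) by (simp add: is_interval_convex)
  define n3 b3 where "n3 s = bcv_form a b (c s) \<bullet> N s" and "b3 s = bcv_form a b (c s) \<bullet> B s" for s
  have pos: "\<kappa> s > 0" if "s \<in> I" for s using F that by (auto simp: frenet_def)
  obtain k1 where k1: "\<forall>s\<in>I. (\<kappa> has_real_derivative k1 s) (at s)" "ndiff I (Suc (Suc (Suc 0))) k1"
    using frenet_curvature_smooth[OF I(1) dom smooth F, of "Suc (Suc (Suc (Suc 0)))"] by auto
  then obtain k2 where k2: "\<forall>s\<in>I. (k1 has_real_derivative k2 s) (at s)" "ndiff I (Suc (Suc 0)) k2"
    by auto
  then obtain k3 where k3: "\<forall>s\<in>I. (k2 has_real_derivative k3 s) (at s)" "ndiff I (Suc 0) k3"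
    by auto
  then obtain k4 where k4: "\<forall>s\<in>I. (k3 has_real_derivative k4 s) (at s)"
    by auto
  have d: "(\<kappa> has_real_derivative k1 s) (at s)" "(k1 has_real_derivative k2 s) (at s)"
    "(k2 has_real_derivative k3 s) (at s)" "(k3 has_real_derivative k4 s) (at s)" if "s \<in> I" for s
    using k1 k2 k3 k4 that by auto
  note eqs = triharmonic_frenet_equations[OF I(1) dom smooth unit tri F d, folded n3_def b3_def]
  have b3': "(b3 has_real_derivative b/2 * n3 s) (at s)" if s: "s \<in> I" for s
  proof -
    have p: "c s \<in> bcv_domain a" using dom s by blast
    let ?t = "coframe a b (c s) (vel c s)" and ?n = "coframe a b (c s) (N s)"
    have on: "?t \<bullet> ?t = 1" "?n \<bullet> ?n = 1" "?n \<bullet> ?t = 0"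
      using F unit s by (auto simp: frenet_def unit_speed_def g_inner_coframe)
    have B: "(\<lambda>t. B t $ k) differentiable (at s)" "covD a b c B s = 0"
      "coframe a b (c s) (B s) = cross3 ?t ?n" for k
      using F s by (auto simp: frenet_def coframe_cross[OF p])
    show ?thesis
      using vertical_component_deriv[OF I(1) dom smooth s B(1), where b = b] cross3_orthonormal(1)[OF on]
      unfolding b3_def n3_def by (simp add: B(2,3) coframe_simps)
  qed
  \<comment> \<open>Continuity of \<open>n3\<close> and \<open>b3\<close> makes the set
    \<open>U\<close> below open, so that identities on \<open>U\<close> can be
    differentiated.\<close>
  have n3': "continuous_on I n3"
  proof (rule continuous_at_imp_continuous_on, rule ballI)
    fix s assume s: "s \<in> I"
    have "(\<lambda>t. N t $ k) differentiable (at s)" for k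
      using F s by (auto simp: frenet_def)
    from vertical_component_deriv[OF I(1) dom smooth s this, where b = b]
    show "isCont n3 s" unfolding n3_def by (rule DERIV_isCont)
  qed
  have nb: "n3 s * b3 s = 0" if s: "s \<in> I" for s
  proof (rule ccontr)
    assume ne: "n3 s * b3 s \<noteq> 0"
    define U where "U = {t\<in>I. n3 t * b3 t \<noteq> 0}"
    have "continuous_on I (\<lambda>t. n3 t * b3 t)"
      using b3' by (intro continuous_on_mult n3' continuous_at_imp_continuous_on) (blast dest: DERIV_isCont)
    then have "open (I \<inter> (\<lambda>t. n3 t * b3 t) -` (- {0}))"
      using I(1) continuous_on_open_vimage by (metis Int_commute open_Compl closed_singleton)
    also have "I \<inter> (\<lambda>t. n3 t * b3 t) -` (- {0}) = U" by (auto simp: U_def)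
    finally have U: "open U" "s \<in> U" "U \<subseteq> I" using s ne by (auto simp: U_def)
    have k2: "k2 t - 2 * (\<kappa> t)^3 = 0" if "t \<in> U" for t
      using eqs(3)[of t] that ab by (auto simp: U_def)
    have k3: "k3 t = 6 * (\<kappa> t)^2 * k1 t" if t: "t \<in> U" for t
    proof -
      have "((\<lambda>t. k2 t - 2 * (\<kappa> t)^3) has_real_derivative k3 t - 6 * (\<kappa> t)^2 * k1 t) (at t)"
        using t U(3) by (auto intro!: derivative_eq_intros d)
      then have "k3 t - 6 * (\<kappa> t)^2 * k1 t = 0"
        by (rule zero_deriv_of_zero[OF U(1) t, rotated]) (rule k2)
      then show ?thesis by simp
    qed
    have k1: "k1 t = 0" if t: "t \<in> U" for t
    proof -
      have "8 * (\<kappa> t)^3 * k1 t = 0"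
        using eqs(1)[of t] k2[OF t] k3[OF t] t U(3)
        by (auto simp: algebra_simps power2_eq_square power3_eq_cube)
      then show ?thesis using pos[of t] t U(3) by auto
    qed
    have "k2 s = 0"
      by (rule zero_deriv_of_zero[OF U(1,2) k1 d(2)[OF s]])
    then show False using k2[OF U(2)] pos[OF s] by simp
  qed
  have "\<exists>C. \<forall>s\<in>I. (b3 s)^2 = C"
  proof (rule has_field_derivative_zero_constant[OF conv])
    fix s assume s: "s \<in> I"
    have "((\<lambda>s. (b3 s)^2) has_real_derivative b * (n3 s * b3 s)) (at s)"
      by (auto intro!: derivative_eq_intros b3' s)
    then show "((\<lambda>s. (b3 s)^2) has_real_derivative 0) (at s within I)"
      using nb[OF s] by (simp add: has_field_derivative_at_within)
  qed
  then obtain C where C: "\<And>s. s \<in> I \<Longrightarrow> (b3 s)^2 = C" by blast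
  have bn: "b * n3 s = 0" if s: "s \<in> I" for s
  \<comment> \<open>If C = 0, then \<open>b3\<close> vanishes on all of \<open>I\<close>, hence so
    does its derivative \<open>b/2 * n3\<close>. Otherwise \<open>b3\<close> has no zero and
    \<open>nb\<close> forces \<open>n3 = 0\<close>.\<close>
  proof (cases "C = 0")
    case True
    have "b/2 * n3 s = 0"
      by (rule zero_deriv_of_zero[OF I(1) s _ b3'[OF s]]) (use C True in simp)
    then show ?thesis by simp
  next
    case False
    then have "b3 s \<noteq> 0" using C[OF s] by auto
    then show ?thesis using nb[OF s] by simp
  qed
  show bc: "\<exists>b3. \<forall>s\<in>I. bcv_form a b (c s) \<bullet> B s = b3"
    unfolding b3_def[symmetric]
  proof (rule has_field_derivative_zero_constant[OF conv])
    fix s assume s: "s \<in> I"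
    have "b/2 * n3 s = 0" using bn[OF s] by simp
    then show "(b3 has_real_derivative 0) (at s within I)"
      using b3'[OF s] by (simp only: has_field_derivative_at_within)
  qed
  show "b * (bcv_form a b (c s) \<bullet> N s) = 0" if "s \<in> I" for s
    using bn[OF that] by (simp add: n3_def)
  have kz: "k1 s = 0" if s: "s \<in> I" for s
  proof (rule curvature_ode_constant[OF I d pos, where K = "b^2 / 4 + (4 * a - b^2) * C"])
    show "2 * k1 s * k2 s + \<kappa> s * k3 s = 2 * (\<kappa> s)^3 * k1 s" if "s \<in> I" for s
      by (rule eqs(1)[OF _ _ _ _ that])
    show "k4 s - 10 * (\<kappa> s)^2 * k2 s - 15 * \<kappa> s * (k1 s)^2 + (\<kappa> s)^5
      + (k2 s - 2 * (\<kappa> s)^3) * (b^2 / 4 + (4 * a - b^2) * C) = 0" if "s \<in> I" for s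
      using eqs(2)[OF _ _ _ _ that] C[OF that] by simp
  qed (use s in auto)
  show "\<exists>k. \<forall>s\<in>I. \<kappa> s = k"
  proof (rule has_field_derivative_zero_constant[OF conv])
    fix s assume "s \<in> I"
    then show "(\<kappa> has_real_derivative 0) (at s within I)"
      using d(1) kz by (metis has_field_derivative_at_within)
  qed
  show "(\<kappa> s)^2 = 2 * (b^2 / 4 + (4 * a - b^2) * (bcv_form a b (c s) \<bullet> B s)^2)" if s: "s \<in> I" for s
  proof -
    have k2: "k2 s = 0" if s: "s \<in> I" for s
      by (rule zero_deriv_of_zero[OF I(1) s kz d(2)[OF s]])
    have k3: "k3 s = 0" if s: "s \<in> I" for s
      by (rule zero_deriv_of_zero[OF I(1) s k2 d(3)[OF s]])
    have k4: "k4 s = 0"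
      by (rule zero_deriv_of_zero[OF I(1) s k3 d(4)[OF s]])
    have "(\<kappa> s)^3 * ((\<kappa> s)^2 - 2 * (b^2 / 4 + (4 * a - b^2) * (b3 s)^2)) = 0"
      using eqs(2)[OF _ _ _ _ s] kz[OF s] k2[OF s] k4 by (simp add: algebra_simps eval_nat_numeral)
    then show ?thesis using pos[OF s] by (auto simp: b3_def)
  qed
qed

text \<open>If N and B are both orthogonal to E3, then T is E3 up to sign and the curve is a
  vertical line. Such lines are geodesics, whereas \<kappa> > 0 and N is a unit vector. The lemma
  serves to exclude \<open>B\<^sub>3 = 0\<close>.\<close>

lemma frenet_normal_binormal_not_horizontal:
  assumes I: "open I" and s: "s \<in> I" and dom: "\<forall>s\<in>I. c s \<in> bcv_domain a"
    and smooth: "smooth_curve I c"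
    and unit: "unit_speed a b I c"
    and F: "frenet a b I c \<kappa> N B (\<lambda>_. 0)"
    and z: "\<And>s. s \<in> I \<Longrightarrow> bcv_form a b (c s) \<bullet> N s = 0" "\<And>s. s \<in> I \<Longrightarrow> bcv_form a b (c s) \<bullet> B s = 0"
  shows False
proof -
  have T0: "vel c s $ 1 = 0 \<and> vel c s $ 2 = 0" if s: "s \<in> I" for s
  proof -
    have p: "c s \<in> bcv_domain a" using dom s by blast
    let ?t = "coframe a b (c s) (vel c s)" and ?n = "coframe a b (c s) (N s)"
    have on: "?t \<bullet> ?t = 1" "?n \<bullet> ?n = 1" "?n \<bullet> ?t = 0"
      using F unit s by (auto simp: frenet_def unit_speed_def g_inner_coframe)
    have "coframe a b (c s) (B s) = cross3 ?t ?n"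
      using F s by (auto simp: frenet_def coframe_cross[OF p])
    then have "cross3 ?t ?n $ 3 = 0" "?n $ 3 = 0"
      using z[OF s] by (metis coframe_simps(3))+
    then have "(?t$3)^2 = 1"
      using cross3_orthonormal(2)[OF on] by simp
    then have "?t$1 * ?t$1 + ?t$2 * ?t$2 = 0"
      using on(1) by (simp add: inner_vec_def sum_3 power2_eq_square)
    then have "?t$1 = 0" "?t$2 = 0" by (simp_all add: sum_squares_eq_zero_iff)
    moreover have "rlam a (c s) \<noteq> 0" using p by (auto simp: bcv_domain_def rlam_def)
    ultimately show ?thesis by (simp add: coframe_simps)
  qed
  have pos: "\<kappa> s > 0" "covD a b c (vel c) s = \<kappa> s *\<^sub>R N s" "coframe a b (c s) (N s) \<bullet> coframe a b (c s) (N s) = 1"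
    using F s by (auto simp: frenet_def g_inner_coframe)
  have d: "((\<lambda>t. vel c t $ k) has_real_derivative deriv (\<lambda>t. vel c t $ k) s) (at s)" for k
    using ndiff_vel[OF I dom smooth, of 1 k] s
    unfolding DERIV_deriv_iff_real_differentiable by (auto simp: real_differentiable_def)
  have "deriv (\<lambda>t. vel c t $ 1) s = 0" "deriv (\<lambda>t. vel c t $ 2) s = 0"
    by (rule zero_deriv_of_zero[OF I s _ d]; use T0 in simp)+
  \<comment> \<open>With T vertical only the Christoffel symbols with both lower indices 3
    contribute, and they vanish.\<close>
  then have "covD a b c (vel c) s $ 1 = 0" "covD a b c (vel c) s $ 2 = 0"
    using covD_nth[OF I dom smooth s d] T0[OF s]
    by (simp_all add: sum_3 bcv_christoffel_def christoffel_table_def Let_def doubleton_eq_iff)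
  then have "N s $ 1 = 0" "N s $ 2 = 0" using pos by simp_all
  then have "coframe a b (c s) (N s) = 0"
    using z(1)[OF s] by (simp add: vec_eq_iff forall_3 coframe_simps)
  then show False using pos(3) by simp
qed

theorem theorem4p6:
  fixes a b :: real and I :: "real set" and c :: "real \<Rightarrow> real^3"
  assumes "4 * a \<noteq> b^2"
    and "open I" and "is_interval I" and "I \<noteq> {}"
    and "\<forall>s\<in>I. c s \<in> bcv_domain a"
    and "smooth_curve I c"
    and "unit_speed a b I c"
    and "triharmonic a b I c"
    and "geodesic a b I c \<or> (\<exists>\<kappa> N B. frenet a b I c \<kappa> N B (\<lambda>_. 0))"
  shows "(geodesic a b I c \<or>
          (\<exists>\<kappa> N B \<kappa>\<^sub>o B\<^sub>3. frenet a b I c \<kappa> N B (\<lambda>_. 0)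
             \<and> (\<forall>s\<in>I. \<kappa> s = \<kappa>\<^sub>o \<and> g_inner a b (c s) (B s) (bcv_E a b (c s) 3) = B\<^sub>3)
             \<and> \<kappa>\<^sub>o^2 = 2 * (b^2 / 4 + (4 * a - b^2) * B\<^sub>3^2)
             \<and> (b^2 > 4 * a \<longrightarrow> B\<^sub>3^2 < b^2 / (4 * (b^2 - 4 * a)))
             \<and> (b^2 < 4 * a \<longrightarrow> B\<^sub>3 \<noteq> 0)))
         \<and> (b = 0 \<and> a < 0 \<longrightarrow> geodesic a b I c)"
proof (cases "geodesic a b I c")
  case False
  then obtain \<kappa> N B where F: "frenet a b I c \<kappa> N B (\<lambda>_. 0)" using assms(9) by blast
  note const = triharmonic_frenet_constant[OF assms(1-3,5-8) F]
  obtain b3 where b3: "\<And>s. s \<in> I \<Longrightarrow> bcv_form a b (c s) \<bullet> B s = b3" using const(1) by blast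
  obtain k where k: "\<And>s. s \<in> I \<Longrightarrow> \<kappa> s = k" using const(4) by blast
  obtain s0 where s0: "s0 \<in> I" using assms(4) by blast
  have k0: "k > 0" using F s0 k by (auto simp: frenet_def)
  have kk: "k^2 = 2 * (b^2 / 4 + (4 * a - b^2) * b3^2)" using const(3)[OF s0] k b3 s0 by simp
  \<comment> \<open>Positivity of half of \<kappa>^2 is the source of the strict bound on
    \<open>b3\<close>, of \<open>b3 \<noteq> 0\<close>, and of the exclusion of b = 0, a <
    0.\<close>
  have k2: "0 < b^2 / 4 + (4 * a - b^2) * b3^2" using kk k0 by (smt (verit) zero_less_power2)
  have bd: "b3^2 < b^2 / (4 * (b^2 - 4 * a))" if "b^2 > 4 * a"
    using k2 that by (simp add: field_simps)
  have nz: "b3 \<noteq> 0"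
  proof
    assume z: "b3 = 0"
    \<comment> \<open>If \<open>b3 = 0\<close>, positivity leaves b^2 / 4 > 0. Then
      \<open>b * n3 = 0\<close> makes N horizontal as well as B, which has just been
      excluded.\<close>
    then have "b \<noteq> 0" using k2 by auto
    then have "bcv_form a b (c s) \<bullet> N s = 0" if "s \<in> I" for s using const(2)[OF that] by simp
    then show False
      by (rule frenet_normal_binormal_not_horizontal[OF assms(2) s0 assms(5-7) F]) (use b3 z in auto)
  qed
  have g: "g_inner a b (c s) (B s) (bcv_E a b (c s) 3) = b3" if "s \<in> I" for s
    using coframe_E[of "c s" a b 3] b3[OF that] that assms(5)
    by (simp add: g_inner_coframe inner_axis coframe_simps)
  have "\<not> (b = 0 \<and> a < 0)"
  proof
    assume "b = 0 \<and> a < 0"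
    then have "a * b3^2 > 0" using k2 by simp
    then show False using \<open>b = 0 \<and> a < 0\<close> by (auto simp: zero_less_mult_iff)
  qed
  moreover have "\<exists>\<kappa> N B k b3. frenet a b I c \<kappa> N B (\<lambda>_. 0)
      \<and> (\<forall>s\<in>I. \<kappa> s = k \<and> g_inner a b (c s) (B s) (bcv_E a b (c s) 3) = b3)
      \<and> k^2 = 2 * (b^2 / 4 + (4 * a - b^2) * b3^2)
      \<and> (b^2 > 4 * a \<longrightarrow> b3^2 < b^2 / (4 * (b^2 - 4 * a)))
      \<and> (b^2 < 4 * a \<longrightarrow> b3 \<noteq> 0)"
    by (rule exI[of _ \<kappa>], rule exI[of _ N], rule exI[of _ B], rule exI[of _ k], rule exI[of _ b3])
      (use F k kk bd nz g in simp)
  ultimately show ?thesis by blast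
qed blast

end
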